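(* Let $X$ be an SCLCS and $n\ge2$. Suppose that $f:[0,+\infty)^n\to X$ is a locally integrable function, $(\lambda_1^0,\dots,\lambda_n^0)\in\Omega_b(f)$, and there exist real numbers $a_1>\Re\lambda_1^0,\dots,a_n>\Re\lambda_n^0$ such that $(\mathcal Lf)(\lambda_1,\dots,\lambda_n)=0$ for all real $\lambda_1>a_1,\dots,\lambda_n>a_n$. Then, for every seminorm $p\in\circledast$, there exists a Lebesgue measurable set $N_p\subseteq[0,+\infty)^n$ such that $m(N_p)=0$ and $p(f(t_1,\dots,t_n))=0$ for all $(t_1,\dots,t_n)\in[0,+\infty)^n\setminus N_p$. In particular, if $X$ is a Fréchet space, then $f(t_1,\dots,t_n)=0$ for a.e. $(t_1,\dots,t_n)\in[0,+\infty)^n$.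
   Context: An SCLCS is a Hausdorff sequentially complete locally convex space over $\mathbb C$; $\circledast$ denotes a fundamental system of seminorms defining the topology of $X$; $m$ is Lebesgue measure. Integration (with respect to Lebesgue measure): for a compact set $K$, a function $f:K\to X$ is integrable if there is a sequence $(f_k)$ of simple functions with $f_k(t)\to f(t)$ for a.e. $t\in K$ and such that for every $\epsilon>0$ and $p\in\circledast$ there is $k_0$ with $\int_K p(f_k-f_l)\le\epsilon$ for all $k,l\ge k_0$; then $\int_K f:=\lim_k\int_K f_k$. A function $f:[0,+\infty)^n\to X$ is locally integrable if its restriction to every compact subset is integrable. For locally integrable $f$ and $\lambda=(\lambda_1,\dots,\lambda_n)\in\mathbb C^n$ put $I_\lambda(t_1,\dots,t_n):=\int_0^{t_1}\cdots\int_0^{t_n}e^{-\lambda_1s_1-\dots-\lambda_ns_n}f(s_1,\dots,s_n)\,ds_1\cdots ds_n$. Then $(\mathcal Lf)(\lambda):=\lim_{t_1\to+\infty;\dots;t_n\to+\infty}I_\lambda(t_1,\dots,t_n)$ (joint limit in $X$) whenever it exists, and $\Omega_b(f)$ is the set of all $\lambda$ such that $\{I_\lambda(t_1,\dots,t_n):t_1\ge0,\dots,t_n\ge0\}$ is bounded in $X$. (If $\lambda^0\in\Omega_b(f)$ and $\Re\lambda_j>\Re\lambda_j^0$ for all $j$, then $(\mathcal Lf)(\lambda)$ exists.) *)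

theory Defs
  imports "HOL-Analysis.Analysis"
begin

definition seminorm :: "(complex \<Rightarrow> 'a::ab_group_add \<Rightarrow> 'a) \<Rightarrow> ('a \<Rightarrow> real) \<Rightarrow> bool" where
  "seminorm scal p \<longleftrightarrow>
     (\<forall>x y. p (x + y) \<le> p x + p y) \<and> (\<forall>c x. p (scal c x) = cmod c * p x)"

definition cauchy_seq :: "(nat \<Rightarrow> 'a::{ab_group_add,topological_space}) \<Rightarrow> bool" where
  "cauchy_seq x \<longleftrightarrow>
     (\<forall>U. open U \<longrightarrow> 0 \<in> U \<longrightarrow> (\<exists>N. \<forall>k\<ge>N. \<forall>l\<ge>N. x k - x l \<in> U))"

(* The Hausdorff property is the class t2_space.  The family P is an arbitrary family of
   seminorms generating the topology; it need not be directed, hence the finite subsets F. *)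
locale sclcs = vector_space scal
  for scal :: "complex \<Rightarrow> 'a::{ab_group_add,t2_space} \<Rightarrow> 'a" +
  fixes P :: "('a \<Rightarrow> real) set"
  assumes seminorms: "p \<in> P \<Longrightarrow> seminorm scal p"
    and topology: "open U \<longleftrightarrow>
      (\<forall>x\<in>U. \<exists>F e. finite F \<and> F \<subseteq> P \<and> 0 < e \<and> {y. \<forall>p\<in>F. p (y - x) < e} \<subseteq> U)"
    and seq_complete: "cauchy_seq (x :: nat \<Rightarrow> 'a) \<Longrightarrow> convergent x"

definition lc_bounded ::
    "(complex \<Rightarrow> 'a::{ab_group_add,topological_space} \<Rightarrow> 'a) \<Rightarrow> 'a set \<Rightarrow> bool" where
  "lc_bounded scal B \<longleftrightarrow>
     (\<forall>U. open U \<longrightarrow> 0 \<in> U \<longrightarrow> (\<exists>r>0. \<forall>c. r < cmod c \<longrightarrow> B \<subseteq> scal c ` U))"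

(* To be used for a locally convex topology: together with local convexity it says that the
   space is Frechet. *)
definition complete_invariant_metrizable :: "'a::{ab_group_add,topological_space} itself \<Rightarrow> bool" where
  "complete_invariant_metrizable _ \<longleftrightarrow>
     (\<exists>d :: 'a \<Rightarrow> 'a \<Rightarrow> real.
        Metric_space UNIV d \<and>
        Metric_space.mtopology UNIV d = euclidean \<and>
        Metric_space.mcomplete UNIV d \<and>
        (\<forall>x y z. d (x + z) (y + z) = d x y))"

definition frechet ::
    "(complex \<Rightarrow> 'a::{ab_group_add,t2_space} \<Rightarrow> 'a) \<Rightarrow> ('a \<Rightarrow> real) set \<Rightarrow> bool" where
  "frechet scal P \<longleftrightarrow> sclcs scal P \<and> complete_invariant_metrizable TYPE('a)"

definition simple_lc_integral ::
    "(complex \<Rightarrow> 'a \<Rightarrow> 'a) \<Rightarrow> 'b::euclidean_space set \<Rightarrow> ('b \<Rightarrow> 'a::ab_group_add) \<Rightarrow> 'a" where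
  "simple_lc_integral scal K g =
     (\<Sum>y\<in>g ` K. scal (of_real (measure lebesgue (g -` {y} \<inter> K))) y)"

definition approximating_seq ::
    "('a \<Rightarrow> real) set \<Rightarrow> 'b::euclidean_space set \<Rightarrow> ('b \<Rightarrow> 'a::{ab_group_add,topological_space})
      \<Rightarrow> (nat \<Rightarrow> 'b \<Rightarrow> 'a) \<Rightarrow> bool" where
  "approximating_seq P K f g \<longleftrightarrow>
     (\<forall>k. simple_function (lebesgue_on K) (g k)) \<and>
     (AE t in lebesgue_on K. (\<lambda>k. g k t) \<longlonglongrightarrow> f t) \<and>
     (\<forall>e>0. \<forall>p\<in>P. \<exists>k0. \<forall>k\<ge>k0. \<forall>l\<ge>k0.
        (\<integral>t. p (g k t - g l t) \<partial>lebesgue_on K) \<le> e)"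

definition lc_integrable_on ::
    "('a \<Rightarrow> real) set \<Rightarrow> ('b::euclidean_space \<Rightarrow> 'a::{ab_group_add,topological_space})
      \<Rightarrow> 'b set \<Rightarrow> bool" where
  "lc_integrable_on P f K \<longleftrightarrow> (\<exists>g. approximating_seq P K f g)"

(* The limit exists and does not depend on the approximating sequence if K is compact and
   f is integrable on K with values in a Hausdorff sequentially complete space. *)
definition lc_integral ::
    "(complex \<Rightarrow> 'a \<Rightarrow> 'a) \<Rightarrow> ('a \<Rightarrow> real) set \<Rightarrow> 'b::euclidean_space set
      \<Rightarrow> ('b \<Rightarrow> 'a::{ab_group_add,topological_space}) \<Rightarrow> 'a" where
  "lc_integral scal P K f =
     (THE y. \<exists>g. approximating_seq P K f g \<and> (\<lambda>k. simple_lc_integral scal K (g k)) \<longlonglongrightarrow> y)"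

definition orthant :: "(real ^ 'n) set" where
  "orthant = {t. \<forall>j. 0 \<le> t $ j}"

definition locally_integrable ::
    "('a \<Rightarrow> real) set \<Rightarrow> (real ^ 'n \<Rightarrow> 'a::{ab_group_add,topological_space}) \<Rightarrow> bool" where
  "locally_integrable P f \<longleftrightarrow> (\<forall>K. compact K \<longrightarrow> K \<subseteq> orthant \<longrightarrow> lc_integrable_on P f K)"

definition truncated_laplace ::
    "(complex \<Rightarrow> 'a \<Rightarrow> 'a) \<Rightarrow> ('a \<Rightarrow> real) set \<Rightarrow> (real ^ 'n \<Rightarrow> 'a::{ab_group_add,topological_space})
      \<Rightarrow> complex ^ 'n \<Rightarrow> real ^ 'n \<Rightarrow> 'a" where
  "truncated_laplace scal P f l t =
     lc_integral scal P (cbox 0 t)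
       (\<lambda>s. scal (exp (- (\<Sum>j\<in>UNIV. l $ j * of_real (s $ j)))) (f s))"

definition coords_at_top :: "(real ^ 'n) filter" where
  "coords_at_top = (INF j. filtercomap (\<lambda>t. t $ j) at_top)"

definition has_laplace ::
    "(complex \<Rightarrow> 'a \<Rightarrow> 'a) \<Rightarrow> ('a \<Rightarrow> real) set \<Rightarrow> (real ^ 'n \<Rightarrow> 'a::{ab_group_add,topological_space})
      \<Rightarrow> complex ^ 'n \<Rightarrow> 'a \<Rightarrow> bool" where
  "has_laplace scal P f l L \<longleftrightarrow> (truncated_laplace scal P f l \<longlongrightarrow> L) coords_at_top"

definition Omega_b ::
    "(complex \<Rightarrow> 'a \<Rightarrow> 'a) \<Rightarrow> ('a \<Rightarrow> real) set \<Rightarrow> (real ^ 'n \<Rightarrow> 'a::{ab_group_add,topological_space})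
      \<Rightarrow> (complex ^ 'n) set" where
  "Omega_b scal P f = {l. lc_bounded scal (truncated_laplace scal P f l ` orthant)}"

end

(* Fix a seminorm p and a linear functional phi with |phi| <= p. The bounded truncated transforms
   at l0 are the primitives H(t) of k(u) = exp(-l0 u) phi(f(u)) over the boxes [0,t]. For m with
   positive real parts, Fubini gives
     int_{[0,T]} exp(-m u) k(u) du = (prod_j m_j) int_{[0,oo)^n} exp(-m s) H(min(s,T)) ds,
   which trades the conditionally convergent transform of k for the absolutely convergent one of H.
   Hence exp(-m s) H(s) has integral 0 for all m = a + 1 - l0 + q with q a multi-index, and the
   Stone-Weierstrass theorem in the variables exp(-s_j) yields H = 0, so phi(f) = 0 almost
   everywhere. Since f is almost everywhere a limit of simple functions, countably many functionals
   (from the Hahn-Banach theorem) norm its values, so p(f) = 0 almost everywhere. *)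

theory Submission
  imports Defs
begin

section \<open>The Hahn--Banach theorem for seminorms\<close>

text \<open>Boundedness at \<open>l0\<close> yields nothing but a bound on the primitive
  \<open>H\<close>. Three gaps have to be closed around it. First, the moments give
  \<open>H = 0\<close> only almost everywhere, whereas recovering the integrand needs every box;
  here \<open>H\<close> is continuous from above, so zeros of \<open>H\<close> just above a point
  force a zero at that point. Secondly, the null set off which \<open>\<phi> (f t) = 0\<close>
  depends on \<open>\<phi>\<close>, and \<open>X\<close> may need uncountably many functionals to
  norm all its points; the values of one approximating sequence on a box form a countable set, and
  norming these values is enough. The same difficulty returns with \<open>p\<close> in place of
  \<open>\<phi>\<close>: the null sets of all \<open>p\<close> can be merged in a Frechet space,
  where countably many members of \<open>P\<close> separate points. Thirdly, the vector integral is
  a definite description, so it is handled only through functionals: \<phi> of the integral is the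
  scalar integral of \<phi> after f. Convergence of the integrals of simple functions and uniqueness
  of their limit are also obtained from norming functionals, which is why the Hahn-Banach theorem
  comes first.\<close>

definition sublinear :: "(complex \<Rightarrow> 'a::ab_group_add \<Rightarrow> 'a) \<Rightarrow> ('a \<Rightarrow> real) \<Rightarrow> bool" where
  "sublinear scal q \<longleftrightarrow>
     (\<forall>x y. q (x + y) \<le> q x + q y) \<and> (\<forall>r x. 0 \<le> r \<longrightarrow> q (scal (of_real r) x) = r * q x)"

text \<open>An inequality for positive factors is enough: applied to \<open>inverse r\<close> it
  gives the reverse inequality. Infima naturally yield only one direction.\<close>

lemma sublinearI:
  assumes "vector_space scal"
    and add: "\<And>x y. q (x + y) \<le> q x + q y"
    and zero: "q 0 = 0"
    and scale: "\<And>r x. 0 < r \<Longrightarrow> q (scal (of_real r) x) \<le> r * q x"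
  shows "sublinear scal q"
proof -
  interpret vector_space scal by fact
  have "q (scal (of_real r) x) = r * q x" if "0 \<le> r" for r x
  proof (cases "r = 0")
    case False
    with that have r: "0 < r" by simp
    have "q x = q (scal (of_real (inverse r)) (scal (of_real r) x))"
      using r by (simp flip: of_real_mult)
    also have "\<dots> \<le> inverse r * q (scal (of_real r) x)"
      using r by (intro scale) auto
    finally have "r * q x \<le> q (scal (of_real r) x)"
      using r by (simp add: field_simps)
    with scale[OF r, of x] show ?thesis by simp
  qed (simp add: zero)
  with add show ?thesis by (simp add: sublinear_def)
qed

lemma sublinearD:
  assumes "vector_space scal" "sublinear scal q"
  shows "q (x + y) \<le> q x + q y" "0 \<le> r \<Longrightarrow> q (scal (of_real r) x) = r * q x"
    "q 0 = 0" "- q (- x) \<le> q x"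
proof -
  interpret vector_space scal by fact
  show *: "q (x + y) \<le> q x + q y" "0 \<le> r \<Longrightarrow> q (scal (of_real r) x) = r * q x" for x y r
    using assms(2) by (auto simp: sublinear_def)
  show "q 0 = 0" using *(2)[of 0 0] by simp
  then show "- q (- x) \<le> q x" using *(1)[of x "-x"] by simp
qed

text \<open>The tilt of \<open>q\<close> lies below \<open>q\<close> and is linear along \<open>x0\<close>; a minimal \<open>q\<close> is therefore fixed
  by all tilts.\<close>

definition tilt :: "(complex \<Rightarrow> 'a::ab_group_add \<Rightarrow> 'a) \<Rightarrow> ('a \<Rightarrow> real) \<Rightarrow> 'a \<Rightarrow> 'a \<Rightarrow> real" where
  "tilt scal q x0 x = (INF t\<in>{0..}. q (x + scal (of_real t) x0) - t * q x0)"

lemma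
  assumes vs: "vector_space scal" and q: "sublinear scal q"
  shows tilt_le: "0 \<le> t \<Longrightarrow> tilt scal q x0 x \<le> q (x + scal (of_real t) x0) - t * q x0"
    and sublinear_tilt: "sublinear scal (tilt scal q x0)"
proof -
  interpret vector_space scal by fact
  note qD = sublinearD[OF vs q]
  \<comment> \<open>This bound does not depend on \<open>t\<close>, so the infimum defining the tilt
    is a genuine one.\<close>
  have "- q (- x) \<le> q (x + scal (of_real t) x0) - t * q x0" if "0 \<le> t" for t x
    using qD(1)[of "x + scal (of_real t) x0" "- x"] qD(2)[OF that, of x0] by simp
  then have bdd: "bdd_below ((\<lambda>t. q (x + scal (of_real t) x0) - t * q x0) ` {0..})" for x
    by (intro bdd_belowI2[where m = "- q (- x)"]) auto
  show le: "tilt scal q x0 x \<le> q (x + scal (of_real t) x0) - t * q x0" if "0 \<le> t" for t x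
    unfolding tilt_def using that by (intro cINF_lower bdd) auto
  have ge: "c \<le> tilt scal q x0 x"
    if "\<And>t. 0 \<le> t \<Longrightarrow> c \<le> q (x + scal (of_real t) x0) - t * q x0" for c x
    unfolding tilt_def using that by (intro cINF_greatest) auto
  show "sublinear scal (tilt scal q x0)"
  proof (rule sublinearI[OF vs])
    fix x y
    \<comment> \<open>Parameters \<open>s\<close> for \<open>x\<close> and \<open>t\<close> for
      \<open>y\<close> combine to the admissible parameter \<open>s + t\<close> for
      \<open>x + y\<close>.\<close>
    have *: "tilt scal q x0 (x + y) \<le> (q (x + scal (of_real s) x0) - s * q x0)
        + (q (y + scal (of_real t) x0) - t * q x0)" if "0 \<le> s" "0 \<le> t" for s t
      using le[of "s + t" "x + y"] that
        qD(1)[of "x + scal (of_real s) x0" "y + scal (of_real t) x0"]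
      by (simp add: algebra_simps scale_left_distrib)
    have "tilt scal q x0 (x + y) - (q (x + scal (of_real s) x0) - s * q x0) \<le> tilt scal q x0 y"
      if "0 \<le> s" for s
      using *[OF that] by (intro ge) (simp add: algebra_simps)
    then have "tilt scal q x0 (x + y) - tilt scal q x0 y \<le> tilt scal q x0 x"
      by (intro ge) (simp add: algebra_simps)
    then show "tilt scal q x0 (x + y) \<le> tilt scal q x0 x + tilt scal q x0 y" by simp
  next
    show "tilt scal q x0 0 = 0"
      using le[of 0 0] ge[of 0 0] by (simp add: qD)
  next
    fix r :: real and x assume r: "0 < r"
    have "tilt scal q x0 (scal (of_real r) x) / r \<le> tilt scal q x0 x"
    proof (rule ge)
      fix t :: real assume t: "0 \<le> t"
      have "scal (of_real r) x + scal (of_real (r * t)) x0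
          = scal (of_real r) (x + scal (of_real t) x0)"
        by (simp add: scale_right_distrib)
      then have "tilt scal q x0 (scal (of_real r) x)
          \<le> r * (q (x + scal (of_real t) x0) - t * q x0)"
        using le[of "r * t" "scal (of_real r) x"] r t qD(2)[of r "x + scal (of_real t) x0"]
        by (simp add: algebra_simps)
      then show "tilt scal q x0 (scal (of_real r) x) / r
          \<le> q (x + scal (of_real t) x0) - t * q x0"
        using r by (simp add: field_simps)
    qed
    then show "tilt scal q x0 (scal (of_real r) x) \<le> r * tilt scal q x0 x"
      using r by (simp add: field_simps)
  qed
qed

text \<open>Zorn's lemma with the pointwise infimum as bound of a chain. The infimum is finite
  because every sublinear q \<le> p satisfies \<open>- p (- x) \<le> q x\<close>.\<close>

lemma minimal_sublinear_exists:
  fixes p :: "'a::ab_group_add \<Rightarrow> real"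
  assumes vs: "vector_space scal" and p: "sublinear scal p"
  obtains m where "sublinear scal m" "\<And>x. m x \<le> p x"
    "\<And>q. sublinear scal q \<Longrightarrow> (\<And>x. q x \<le> m x) \<Longrightarrow> q = m"
proof -
  define A where "A = {q. sublinear scal q \<and> (\<forall>x. q x \<le> p x)}"
  \<comment> \<open>The order is reversed, because \<open>predicate_Zorn\<close> delivers maximal
    elements.\<close>
  define R where "R = (\<lambda>q q' :: 'a \<Rightarrow> real. \<forall>x. q' x \<le> q x)"
  have "\<exists>m\<in>A. \<forall>q\<in>A. R m q \<longrightarrow> q = m"
  proof (rule predicate_Zorn)
    show "partial_order_on A (relation_of R A)"
      by (rule partial_order_on_relation_ofI)
        (auto simp: R_def intro: order_trans intro!: ext antisym)
  next
    fix C assume C: "C \<in> Chains (relation_of R A)"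
    then have CA: "C \<subseteq> A" and chain: "\<And>q q'. q \<in> C \<Longrightarrow> q' \<in> C \<Longrightarrow> R q q' \<or> R q' q"
      by (auto simp: Chains_def relation_of_def)
    show "\<exists>u\<in>A. \<forall>q\<in>C. R q u"
    proof (cases "C = {}")
      case True
      with p show ?thesis by (auto simp: A_def)
    next
      case False
      define u where "u = (\<lambda>x. INF q\<in>C. q x)"
      have sub: "sublinear scal q" if "q \<in> C" for q using that CA by (auto simp: A_def)
      have "- p (- x) \<le> q x" if "q \<in> C" for q x
      proof -
        have "q (- x) \<le> p (- x)" using that CA by (auto simp: A_def)
        then show ?thesis using sublinearD(4)[OF vs sub[OF that], of x] by linarith
      qed
      then have "bdd_below ((\<lambda>q. q x) ` C)" for x
        by (intro bdd_belowI2[where m = "- p (- x)"])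
      then have le: "u x \<le> q x" if "q \<in> C" for q x
        unfolding u_def using that by (intro cINF_lower)
      have ge: "c \<le> u x" if "\<And>q. q \<in> C \<Longrightarrow> c \<le> q x" for c x
        unfolding u_def using that False by (intro cINF_greatest) auto
      have "sublinear scal u"
      proof (rule sublinearI[OF vs])
        fix x y
        \<comment> \<open>Subadditivity of an infimum needs the chain property: of two members the
          smaller one serves for both \<open>x\<close> and \<open>y\<close>.\<close>
        have *: "u (x + y) \<le> q x + q' y" if q: "q \<in> C" "q' \<in> C" for q q'
          using chain[OF q]
        proof
          assume R: "R q q'"
          have "u (x + y) \<le> q' x + q' y"
            using le[OF q(2), of "x + y"] sublinearD(1)[OF vs sub[OF q(2)], of x y] by linarith
          with R show ?thesis by (fastforce simp: R_def intro: order_trans)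
        next
          assume R: "R q' q"
          have "u (x + y) \<le> q x + q y"
            using le[OF q(1), of "x + y"] sublinearD(1)[OF vs sub[OF q(1)], of x y] by linarith
          with R show ?thesis by (fastforce simp: R_def intro: order_trans)
        qed
        have "u (x + y) - q x \<le> u y" if "q \<in> C" for q
        proof (rule ge)
          fix q' assume "q' \<in> C"
          with *[OF that this] show "u (x + y) - q x \<le> q' y" by linarith
        qed
        then have "u (x + y) - u y \<le> u x"
          by (intro ge) (simp add: algebra_simps)
        then show "u (x + y) \<le> u x + u y" by simp
      next
        from False obtain q where q: "q \<in> C" by auto
        have "u 0 \<le> 0" using le[OF q, of 0] sublinearD(3)[OF vs sub[OF q]] by simp
        moreover have "0 \<le> u 0" by (rule ge) (simp add: sublinearD(3)[OF vs sub])
        ultimately show "u 0 = 0" by simp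
      next
        fix r :: real and x assume r: "0 < r"
        have "u (scal (of_real r) x) / r \<le> u x"
        proof (rule ge)
          fix q assume "q \<in> C"
          then show "u (scal (of_real r) x) / r \<le> q x"
            using le[of q "scal (of_real r) x"] r sublinearD(2)[OF vs sub, of q r x]
            by (simp add: field_simps)
        qed
        then show "u (scal (of_real r) x) \<le> r * u x"
          using r by (simp add: field_simps)
      qed
      moreover have "u x \<le> p x" for x
      proof -
        from False obtain q where q: "q \<in> C" by auto
        then have "q x \<le> p x" using CA by (auto simp: A_def)
        with le[OF q, of x] show ?thesis by linarith
      qed
      ultimately show ?thesis
        using le by (auto simp: A_def R_def intro!: bexI[of _ u])
    qed
  qed
  then obtain m where m: "m \<in> A" and min: "\<And>q. q \<in> A \<Longrightarrow> R m q \<Longrightarrow> q = m" by blast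
  show ?thesis
  proof (rule that)
    show "sublinear scal m" "\<And>x. m x \<le> p x" using m by (auto simp: A_def)
    show "q = m" if "sublinear scal q" "\<And>x. q x \<le> m x" for q
      using m that by (intro min) (auto simp: A_def R_def intro: order_trans)
  qed
qed

text \<open>By minimality \<open>m\<close> equals each of its tilts. The parameter 1 in the tilt
  along \<open>y\<close> then gives \<open>m x + m y \<le> m (x + y)\<close>, the inequality missing
  for additivity.\<close>

lemma minimal_sublinear_additive:
  assumes vs: "vector_space scal" and m: "sublinear scal m"
    and min: "\<And>q. sublinear scal q \<Longrightarrow> (\<And>x. q x \<le> m x) \<Longrightarrow> q = m"
  shows "m (x + y) = m x + m y" "m (scal (of_real r) x) = r * m x"
proof -
  interpret vector_space scal by fact
  note mD = sublinearD[OF vs m]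
  have "tilt scal m x0 = m" for x0
    using tilt_le[OF vs m, of 0 x0] by (intro min sublinear_tilt[OF vs m]) simp
  then have "m x \<le> m (x + y) - m y" for x y
    using tilt_le[OF vs m, of 1 y x] by simp
  then show add: "m (x + y) = m x + m y" for x y
    using mD(1)[of x y] by (simp add: antisym algebra_simps)
  have minus: "m (- x) = - m x" for x
    using add[of x "-x"] mD(3) by simp
  show "m (scal (of_real r) x) = r * m x"
  proof (cases "0 \<le> r")
    case False
    then have "m (scal (of_real (- r)) x) = - r * m x" by (intro mD(2)) simp
    then show ?thesis using minus[of "scal (of_real r) x"] by simp
  qed (rule mD(2))
qed

text \<open>The minimal sublinear minorants of \<open>p\<close> are exactly the real-linear ones, so Zorn's lemma
  yields the Hahn--Banach theorem without extending functionals from subspaces.\<close>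

lemma hahn_banach_seminorm:
  assumes vs: "vector_space scal" and p: "seminorm scal p"
  obtains \<phi> :: "'a::ab_group_add \<Rightarrow> complex" where "Vector_Spaces.linear scal (*) \<phi>"
    "\<And>x. cmod (\<phi> x) \<le> p x" "cmod (\<phi> x0) = p x0"
proof -
  interpret vector_space scal by fact
  have p_add: "p (x + y) \<le> p x + p y" and p_scale: "p (scal c x) = cmod c * p x" for x y c
    using p by (auto simp: seminorm_def)
  have sp: "sublinear scal p" by (simp add: sublinear_def p_add p_scale)
  \<comment> \<open>Minimising below the tilt along \<open>x0\<close> instead of below
    \<open>p\<close> forces \<open>m (- x0) \<le> - p x0\<close>, hence
    \<open>m x0 = p x0\<close>.\<close>
  obtain m where m: "sublinear scal m" "\<And>x. m x \<le> tilt scal p x0 x"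
    "\<And>q. sublinear scal q \<Longrightarrow> (\<And>x. q x \<le> m x) \<Longrightarrow> q = m"
    using minimal_sublinear_exists[OF vs sublinear_tilt[OF vs sp, of x0]] by metis
  note madd = minimal_sublinear_additive(1)[OF vs m(1,3)]
  note mscale = minimal_sublinear_additive(2)[OF vs m(1,3)]
  have mp: "m x \<le> p x" for x
    using m(2)[of x] tilt_le[OF vs sp, of 0 x0 x] by simp
  have "m (- x0) \<le> - p x0"
    using m(2)[of "- x0"] tilt_le[OF vs sp, of 1 x0 "- x0"] sublinearD(3)[OF vs sp] by simp
  then have mx0: "p x0 \<le> m x0"
    using sublinearD(4)[OF vs m(1), of x0] by simp
  \<comment> \<open>The complex-linear functional with real part \<open>m\<close>, that is, m x - i
    m(i x).\<close>
  define \<phi> where "\<phi> = (\<lambda>x. Complex (m x) (- m (scal \<i> x)))"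
  have add: "\<phi> (x + y) = \<phi> x + \<phi> y" for x y
    by (simp add: \<phi>_def madd scale_right_distrib complex_eq_iff)
  have scale: "\<phi> (scal c x) = c * \<phi> x" for c x
  proof -
    have dec: "scal c y = scal (of_real (Re c)) y + scal (of_real (Im c)) (scal \<i> y)" for y
      by (simp add: scale_left_distrib[symmetric] complex_eq_iff mult.commute)
    have m1: "m (scal c y) = Re c * m y + Im c * m (scal \<i> y)" for y
      by (subst dec) (simp only: madd mscale)
    have "scal \<i> (scal c x) = scal c (scal \<i> x)" by (simp add: mult.commute)
    moreover have "m (scal \<i> (scal \<i> x)) = - m x"
      using mscale[of "-1" x] by simp
    ultimately show ?thesis
      by (simp add: \<phi>_def m1 complex_eq_iff del: scale_scale)
  qed
  have bound: "cmod (\<phi> x) \<le> p x" for x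
  proof (cases "\<phi> x = 0")
    case True
    have "0 \<le> p x" using p_add[of x "- x"] p_scale[of "-1" x] p_scale[of 0 x] by simp
    with True show ?thesis by simp
  next
    case False
    \<comment> \<open>A unimodular factor turns \<open>\<phi> x\<close> onto the positive real axis,
      where the modulus is the real part and hence a value of \<open>m\<close>.\<close>
    define c where "c = cnj (\<phi> x) / of_real (cmod (\<phi> x))"
    have "cmod c = 1" using False by (simp add: c_def norm_divide)
    have "c * \<phi> x = of_real (cmod (\<phi> x))"
      using False by (simp add: c_def complex_norm_square[symmetric] power2_eq_square mult.commute)
    then have "cmod (\<phi> x) = Re (\<phi> (scal c x))" by (simp add: scale)
    also have "\<dots> = m (scal c x)" by (simp add: \<phi>_def)
    also have "\<dots> \<le> p x" using mp[of "scal c x"] \<open>cmod c = 1\<close> by (simp add: p_scale)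
    finally show ?thesis .
  qed
  have "p x0 \<le> Re (\<phi> x0)" using mx0 by (simp add: \<phi>_def)
  also have "\<dots> \<le> cmod (\<phi> x0)" by (rule complex_Re_le_cmod)
  finally have "cmod (\<phi> x0) = p x0" using bound[of x0] by simp
  moreover have "Vector_Spaces.linear scal (*) \<phi>"
    by unfold_locales (auto simp: add scale algebra_simps)
  ultimately show ?thesis using that bound by blast
qed

section \<open>The scalar case\<close>

lemma borel_measurable_vec_nth_real [measurable]: "(\<lambda>s::real^'n. s $ j) \<in> borel_measurable borel"
  by (intro borel_measurable_continuous_onI continuous_intros)

definition laplace_kernel :: "complex ^ 'n \<Rightarrow> real ^ 'n \<Rightarrow> complex" where
  "laplace_kernel l s = exp (- (\<Sum>j\<in>UNIV. l $ j * of_real (s $ j)))"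

lemma laplace_kernel_prod: "laplace_kernel l s = (\<Prod>j\<in>UNIV. exp (- l $ j * of_real (s $ j)))"
  by (simp add: laplace_kernel_def exp_sum flip: sum_negf)

lemma laplace_kernel_add: "laplace_kernel (l + m) s = laplace_kernel l s * laplace_kernel m s"
  by (simp add: laplace_kernel_def exp_add[symmetric] algebra_simps sum.distrib)

lemma laplace_kernel_nonzero [simp]: "laplace_kernel l s \<noteq> 0"
  by (simp add: laplace_kernel_def)

lemma continuous_laplace_kernel: "continuous_on A (laplace_kernel l)"
  unfolding laplace_kernel_def by (intro continuous_intros)

lemma borel_measurable_laplace_kernel [measurable]: "laplace_kernel l \<in> borel_measurable borel"
  by (intro borel_measurable_continuous_onI continuous_laplace_kernel)

text \<open>The half-line is encoded by a cut-off function on the whole line, so that the kernel on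
  a shifted orthant becomes a product of such factors.\<close>

lemma
  fixes \<mu> :: complex
  assumes \<mu>: "0 < Re \<mu>"
  shows integrable_exp_atLeast:
      "integrable lborel (\<lambda>x. if u \<le> x then exp (- \<mu> * of_real x) else 0)" (is ?I)
    and integral_exp_atLeast:
      "(LINT x|lborel. (if u \<le> x then exp (- \<mu> * of_real x) else 0)) = exp (- \<mu> * of_real u) / \<mu>"
      (is ?E)
proof -
  let ?f = "\<lambda>x::real. exp (- \<mu> * of_real x)"
  have "integrable lebesgue (\<lambda>x. indicat_real {u..} x *\<^sub>R exp (- Re \<mu> * x))"
    using \<mu> by (intro nonnegative_absolutely_integrable_1 [unfolded set_integrable_def]
        integrable_on_exp_minus_to_infinity) auto
  then have r: "integrable lborel (\<lambda>x. indicat_real {u..} x *\<^sub>R exp (- Re \<mu> * x))"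
    by (subst (asm) integrable_completion) auto
  show I: ?I
    by (rule Bochner_Integration.integrable_bound[OF r]) (auto simp: indicator_def)
  then have Ioi: "set_integrable lborel {u<..} ?f"
    unfolding set_integrable_def
    by (rule Bochner_Integration.integrable_bound) (auto simp: indicator_def)
  have "(?f \<longlongrightarrow> 0) at_top"
  proof (rule tendsto_norm_zero_cancel)
    have "((\<lambda>x. exp (- Re \<mu> * x)) \<longlongrightarrow> 0) at_top"
      using \<mu> by real_asymp
    then show "((\<lambda>x. norm (?f x)) \<longlongrightarrow> 0) at_top" by simp
  qed
  then have B: "((\<lambda>x. - ?f x / \<mu>) \<longlongrightarrow> 0) at_top"
    using tendsto_divide[OF tendsto_minus tendsto_const, of ?f 0 at_top \<mu>] \<mu> by force
  have "(LBINT x=u..\<infinity>. ?f x) = 0 - (- ?f u / \<mu>)"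
  proof (rule interval_integral_FTC_integrable)
    fix x assume "ereal u < ereal x"
    have "((\<lambda>z. - exp (- \<mu> * z) / \<mu>) has_field_derivative exp (- \<mu> * of_real x)) (at (of_real x))"
      using \<mu> by (auto intro!: derivative_eq_intros)
    then show "((\<lambda>x. - ?f x / \<mu>) has_vector_derivative ?f x) (at x)"
      by (rule has_vector_derivative_real_field)
  next
    show "(((\<lambda>x. - ?f x / \<mu>) \<circ> real_of_ereal) \<longlongrightarrow> - ?f u / \<mu>) (at_right (ereal u))"
      unfolding ereal_tendsto_simps1 by (intro tendsto_intros) (use \<mu> in auto)
    show "(((\<lambda>x. - ?f x / \<mu>) \<circ> real_of_ereal) \<longlongrightarrow> 0) (at_left \<infinity>)"
      unfolding ereal_tendsto_simps1 by (rule B)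
    show "set_integrable lborel (einterval (ereal u) \<infinity>) ?f"
      using Ioi by (simp add: einterval_eq)
  qed (auto intro!: continuous_intros)
  also have "(LBINT x=u..\<infinity>. ?f x) = (LINT x|lborel. indicator {u<..} x *\<^sub>R ?f x)"
    by (simp add: interval_integral_Ioi set_lebesgue_integral_def)
  \<comment> \<open>The fundamental theorem of calculus speaks of the open half-line; the endpoint
    \<open>u\<close> is a null set.\<close>
  also have "\<dots> = (LINT x|lborel. (if u \<le> x then ?f x else 0))"
  proof (rule integral_cong_AE)
    show "AE x in lborel. indicator {u<..} x *\<^sub>R ?f x = (if u \<le> x then ?f x else 0)"
      using AE_lborel_singleton[of u] by eventually_elim (auto simp: indicator_def)
  qed auto
  finally show ?E by simp
qed

text \<open>Lebesgue measure on vectors is the image of the product of one-dimensional Lebesgue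
  measures indexed by the basis vectors, so this is Fubini's theorem for products, reindexed from
  basis vectors to coordinates.\<close>

lemma
  fixes f :: "'n::finite \<Rightarrow> real \<Rightarrow> complex"
  assumes f: "\<And>j. integrable lborel (f j)"
  shows integrable_lborel_vec_prod: "integrable lborel (\<lambda>s::real^'n. \<Prod>j\<in>UNIV. f j (s $ j))"
    and integral_lborel_vec_prod:
      "(LINT s|(lborel :: (real^'n) measure). (\<Prod>j\<in>UNIV. f j (s $ j))) = (\<Prod>j\<in>UNIV. LINT x|lborel. f j x)"
proof -
  \<comment> \<open>The coordinate belonging to a basis vector, inverse to
    \<open>\<lambda>j. axis j 1\<close>.\<close>
  define ix where "ix = (\<lambda>b::real^'n. SOME j. b = axis j 1)"
  have ix: "ix (axis j 1) = j" for j
    unfolding ix_def by (rule some_equality) (auto simp: axis_eq_axis)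
  have Basis: "(Basis :: (real^'n) set) = (\<lambda>j. axis j 1) ` UNIV" by (auto simp: Basis_vec_def)
  have inj: "inj (\<lambda>j::'n. axis j (1::real))" by (auto simp: inj_on_def axis_eq_axis)
  have prod_eq: "(\<Prod>b\<in>(Basis :: (real^'n) set). g (ix b) b) = (\<Prod>j\<in>UNIV. g j (axis j 1))"
    for g :: "'n \<Rightarrow> real^'n \<Rightarrow> complex"
    by (simp add: Basis prod.reindex[OF inj] ix)
  let ?P = "\<Pi>\<^sub>M b\<in>(Basis :: (real^'n) set). (lborel :: real measure)"
  let ?h = "\<lambda>g. \<Sum>b\<in>(Basis :: (real^'n) set). g b *\<^sub>R b"
  have comp: "(\<Prod>j\<in>UNIV. f j (?h g $ j)) = (\<Prod>b\<in>(Basis :: (real^'n) set). f (ix b) (g b))" for g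
  proof -
    have "?h g $ j = g (axis j 1)" for j
    proof -
      have "?h g $ j = ?h g \<bullet> axis j 1" by (simp add: inner_axis)
      also have "\<dots> = g (axis j 1)"
        by (rule inner_sum_left_Basis) (auto simp: Basis)
      finally show ?thesis .
    qed
    then show ?thesis using prod_eq[of "\<lambda>j b. f j (g b)"] by simp
  qed
  interpret product_sigma_finite "\<lambda>_ :: real^'n. lborel :: real measure" ..
  have meas: "f j \<in> borel_measurable borel" for j
    using borel_measurable_integrable[OF f[of j]] by simp
  have hm: "?h \<in> measurable ?P borel" by measurable
  have pm: "(\<lambda>s::real^'n. \<Prod>j\<in>UNIV. f j (s $ j)) \<in> borel_measurable borel"
    by (intro borel_measurable_prod measurable_compose[OF borel_measurable_vec_nth_real meas])
  have I: "integrable ?P (\<lambda>g. \<Prod>b\<in>(Basis :: (real^'n) set). f (ix b) (g b))"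
    by (rule product_integrable_prod) (use f in auto)
  have E: "(LINT g|?P. (\<Prod>b\<in>(Basis :: (real^'n) set). f (ix b) (g b)))
      = (\<Prod>b\<in>(Basis :: (real^'n) set). LINT x|lborel. f (ix b) x)"
    by (rule product_integral_prod) (use f in auto)
  show "integrable lborel (\<lambda>s::real^'n. \<Prod>j\<in>UNIV. f j (s $ j))"
    by (subst lborel_eq, subst integrable_distr_eq[OF hm pm]) (use I comp in simp)
  show "(LINT s|(lborel :: (real^'n) measure). (\<Prod>j\<in>UNIV. f j (s $ j))) = (\<Prod>j\<in>UNIV. LINT x|lborel. f j x)"
    by (subst lborel_eq, subst integral_distr[OF hm pm])
      (use E comp prod_eq[of "\<lambda>j b. LINT x|lborel. f j x"] in simp)
qed

text \<open>Read from right to left, the kernel at \<open>u\<close> is an integral over all s \<ge>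
  u. Inserting this for the kernel replaces an integration by parts in each variable and is the
  origin of the factor \<open>\<Prod>j\<in>UNIV. \<mu> $ j\<close> below.\<close>

lemma
  fixes u :: "real^'n" and \<mu> :: "complex^'n"
  assumes \<mu>: "\<And>j. 0 < Re (\<mu> $ j)"
  shows integrable_laplace_kernel: "integrable lborel (\<lambda>s. if u \<le> s then laplace_kernel \<mu> s else 0)"
    and integral_laplace_kernel:
      "(LINT s|lborel. (if u \<le> s then laplace_kernel \<mu> s else 0)) = laplace_kernel \<mu> u / (\<Prod>j\<in>UNIV. \<mu> $ j)"
proof -
  have eq: "(if u \<le> s then laplace_kernel \<mu> s else 0) =
      (\<Prod>j\<in>UNIV. if u $ j \<le> s $ j then exp (- \<mu> $ j * of_real (s $ j)) else 0)" for s
    by (auto simp: laplace_kernel_prod less_eq_vec_def)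
  show "integrable lborel (\<lambda>s. if u \<le> s then laplace_kernel \<mu> s else 0)"
    unfolding eq by (rule integrable_lborel_vec_prod integrable_exp_atLeast \<mu>)+
  show "(LINT s|lborel. (if u \<le> s then laplace_kernel \<mu> s else 0)) = laplace_kernel \<mu> u / (\<Prod>j\<in>UNIV. \<mu> $ j)"
    unfolding eq
    by (subst integral_lborel_vec_prod, rule integrable_exp_atLeast[OF \<mu>])
      (simp only: integral_exp_atLeast[OF \<mu>] laplace_kernel_prod prod_dividef)
qed

text \<open>Moves a varying corner from the domain of integration into the integrand, which makes
  Fubini's theorem and dominated convergence in \<open>s\<close> applicable over one fixed
  box.\<close>

lemma integral_lebesgue_on_cbox_restrict:
  fixes k :: "real^'n \<Rightarrow> 'b::{banach, second_countable_topology}"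
  shows "(LINT u|lebesgue_on (cbox 0 T). (if u \<le> s then k u else 0)) = (LINT u|lebesgue_on (cbox 0 (inf s T)). k u)"
  by (subst (1 2) integral_restrict_space)
    (auto intro!: Bochner_Integration.integral_cong simp: indicator_def simp flip: interval_cbox_cart)

lemma measurable_lebesgue_on_borel: "(\<lambda>u. u) \<in> measurable (lebesgue_on S) borel"
  by (simp add: measurable_completion measurable_restrict_space1)

lemma sets_le_vec [measurable]:
  fixes f g :: "'b \<Rightarrow> real^'n"
  assumes [measurable]: "f \<in> borel_measurable M" "g \<in> borel_measurable M"
  shows "Measurable.pred M (\<lambda>x. f x \<le> g x)"
  unfolding less_eq_vec_def by measurable

text \<open>The kernel at \<open>u\<close> is written as an integral over s \<ge> u, and the two
  integrations are exchanged; the inner one then collects the points u \<le> s of the box.\<close>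

lemma
  fixes k :: "real^'n \<Rightarrow> complex" and \<mu> :: "complex^'n"
  assumes \<mu>: "\<And>j. 0 < Re (\<mu> $ j)" and k: "integrable (lebesgue_on (cbox 0 T)) k"
  defines "H \<equiv> \<lambda>t. LINT u|lebesgue_on (cbox 0 t). k u"
  shows laplace_integration_by_parts:
      "(LINT u|lebesgue_on (cbox 0 T). laplace_kernel \<mu> u * k u) =
       (\<Prod>j\<in>UNIV. \<mu> $ j) * (LINT s|lborel. laplace_kernel \<mu> s * H (inf s T))"
    and borel_measurable_box_integral: "(\<lambda>s. H (inf s T)) \<in> borel_measurable borel"
proof -
  define M where "M = lebesgue_on (cbox 0 T)"
  interpret finite_measure M
    unfolding M_def by (intro finite_measure_lebesgue_on) auto
  have sM: "sigma_finite_measure M" ..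
  interpret pair_sigma_finite M lborel ..
  have [measurable]: "k \<in> borel_measurable M" using k by (auto simp: M_def)
  have [measurable]: "(\<lambda>u. u) \<in> measurable M borel"
    unfolding M_def by (rule measurable_lebesgue_on_borel)
  have [measurable]: "(\<lambda>z. fst z) \<in> borel_measurable (M \<Otimes>\<^sub>M lborel)"
    by (rule measurable_compose[OF measurable_fst]) measurable
  have [measurable]: "(\<lambda>z. snd z) \<in> borel_measurable (M \<Otimes>\<^sub>M (lborel :: (real^'n) measure))"
    using measurable_snd[of M "lborel :: (real^'n) measure"] by simp
  have H: "H (inf s T) = (LINT u|M. (if u \<le> s then k u else 0))" for s
    unfolding H_def M_def integral_lebesgue_on_cbox_restrict ..
  have Hm: "(\<lambda>z. if snd z \<le> fst z then k (snd z) else 0) \<in> borel_measurable (lborel \<Otimes>\<^sub>M M)"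
  proof -
    have [measurable]: "(\<lambda>z. snd z) \<in> borel_measurable (lborel \<Otimes>\<^sub>M M)"
      by (rule measurable_compose[OF measurable_snd]) measurable
    have [measurable]: "(\<lambda>z. fst z) \<in> borel_measurable ((lborel :: (real^'n) measure) \<Otimes>\<^sub>M M)"
      using measurable_fst[of "lborel :: (real^'n) measure" M] by simp
    have [measurable]: "(\<lambda>z. k (snd z)) \<in> borel_measurable ((lborel :: (real^'n) measure) \<Otimes>\<^sub>M M)"
      by (rule measurable_compose[OF measurable_snd]) measurable
    show ?thesis by measurable
  qed
  have "(\<lambda>s. LINT u|M. (if u \<le> s then k u else 0)) \<in> borel_measurable lborel"
    by (rule sigma_finite_measure.borel_measurable_lebesgue_integral[OF sM]) (use Hm in \<open>simp add: case_prod_beta'\<close>)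
  then show "(\<lambda>s. H (inf s T)) \<in> borel_measurable borel" by (simp add: H)
  let ?F = "\<lambda>u s. k u * (if u \<le> s then laplace_kernel \<mu> s else 0)"
  have [measurable]: "(\<lambda>z. k (fst z)) \<in> borel_measurable (M \<Otimes>\<^sub>M (lborel :: (real^'n) measure))"
    by (rule measurable_compose[OF measurable_fst]) measurable
  have Fm [measurable]: "case_prod ?F \<in> borel_measurable (M \<Otimes>\<^sub>M lborel)"
    unfolding case_prod_beta' by measurable
  \<comment> \<open>Points of the box satisfy 0 \<le> u, so the integral over s \<ge> u is bounded
    by this constant, and integrability of \<open>k\<close> alone makes the double integral
    absolutely convergent.\<close>
  let ?C = "LINT s|lborel. cmod (if 0 \<le> s then laplace_kernel \<mu> s else 0)"
  have Fint: "integrable (M \<Otimes>\<^sub>M lborel) (case_prod ?F)"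
  proof (rule Fubini_integrable[OF Fm])
    have "integrable M (\<lambda>u. LINT s|lborel. cmod (?F u s))"
    proof (rule Bochner_Integration.integrable_bound)
      show "integrable M (\<lambda>u. cmod (k u) * ?C)"
        using k by (simp add: M_def)
      show "(\<lambda>u. LINT s|lborel. cmod (?F u s)) \<in> borel_measurable M"
        by (rule sigma_finite_measure.borel_measurable_lebesgue_integral[OF lborel.sigma_finite_measure_axioms]) measurable
      show "AE u in M. norm (LINT s|lborel. cmod (?F u s)) \<le> norm (cmod (k u) * ?C)"
      proof (rule AE_I2)
        fix u assume "u \<in> space M"
        then have u: "0 \<le> u" by (simp add: M_def flip: interval_cbox_cart)
        have "(LINT s|lborel. cmod (if u \<le> s then laplace_kernel \<mu> s else 0)) \<le> ?C"
          using u by (intro integral_mono integrable_norm integrable_laplace_kernel[OF \<mu>])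
            (auto dest: order_trans)
        then have "(LINT s|lborel. cmod (?F u s)) \<le> cmod (k u) * ?C"
          by (simp add: norm_mult mult_left_mono)
        moreover have "0 \<le> (LINT s|lborel. cmod (?F u s))" by simp
        ultimately show "norm (LINT s|lborel. cmod (?F u s)) \<le> norm (cmod (k u) * ?C)" by simp
      qed
    qed
    then show "integrable M (\<lambda>x. LINT y|lborel. cmod (case (x, y) of (u, s) \<Rightarrow> ?F u s))" by simp
    show "AE x in M. integrable lborel (\<lambda>y. case (x, y) of (u, s) \<Rightarrow> ?F u s)"
      by (auto intro!: integrable_laplace_kernel \<mu>)
  qed
  have "(LINT s|lborel. laplace_kernel \<mu> s * H (inf s T)) = (LINT s|lborel. LINT u|M. ?F u s)"
  proof (rule Bochner_Integration.integral_cong[OF refl])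
    fix s
    have "(LINT u|M. ?F u s) = (LINT u|M. laplace_kernel \<mu> s * (if u \<le> s then k u else 0))"
      by (intro Bochner_Integration.integral_cong) auto
    then show "laplace_kernel \<mu> s * H (inf s T) = (LINT u|M. ?F u s)" by (simp add: H)
  qed
  also have "\<dots> = (LINT u|M. LINT s|lborel. ?F u s)" by (rule Fubini_integral[OF Fint])
  also have "\<dots> = (LINT u|M. k u * laplace_kernel \<mu> u) / (\<Prod>j\<in>UNIV. \<mu> $ j)"
    by (simp add: integral_laplace_kernel[OF \<mu>])
  finally have *: "(LINT s|lborel. laplace_kernel \<mu> s * H (inf s T))
      = (LINT u|M. k u * laplace_kernel \<mu> u) / (\<Prod>j\<in>UNIV. \<mu> $ j)" .
  have "\<mu> $ j \<noteq> 0" for j using \<mu>[of j] by auto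
  then have "(\<Prod>j\<in>UNIV. \<mu> $ j) \<noteq> 0" by simp
  with * show "(LINT u|lebesgue_on (cbox 0 T). laplace_kernel \<mu> u * k u) =
       (\<Prod>j\<in>UNIV. \<mu> $ j) * (LINT s|lborel. laplace_kernel \<mu> s * H (inf s T))"
    by (simp add: M_def mult.commute)
qed

section \<open>Functions all of whose box integrals vanish\<close>

lemma AE_orthant_if_AE_boxes:
  assumes "\<And>i::nat. AE u in lebesgue_on (cbox 0 (\<chi> j. real i)). Q u"
  shows "AE u in lebesgue. u \<in> (orthant :: (real^'n) set) \<longrightarrow> Q u"
proof -
  have "AE u in lebesgue. u \<in> cbox 0 (\<chi> j. real i) \<longrightarrow> Q u" for i
    using assms[of i] by (subst (asm) AE_restrict_space_iff) auto
  then have "AE u in lebesgue. \<forall>i::nat. u \<in> cbox 0 (\<chi> j. real i) \<longrightarrow> Q u"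
    unfolding AE_all_countable by blast
  then show ?thesis
  proof eventually_elim
    case (elim u)
    obtain i :: nat where "Max (range (\<lambda>j. u $ j)) \<le> real i" using real_arch_simple by blast
    then have "u $ j \<le> real i" for j by (meson Max_ge finite finite_imageI order_trans rangeI)
    then have "u \<in> cbox 0 (\<chi> j. real i)" if "u \<in> orthant"
      using that by (simp add: orthant_def mem_box_cart)
    with elim show ?case by blast
  qed
qed

text \<open>Inside a fixed box, the sets \<open>{..a}\<close> cut out smaller boxes. They are closed
  under intersection and generate the Borel sets, so by Dynkin's argument the integral vanishes over
  every Borel set, and then over every Lebesgue set.\<close>

lemma zero_on_boxes_imp_AE_zero:
  fixes g :: "real^'n \<Rightarrow> complex"
  assumes int: "\<And>T. integrable (lebesgue_on (cbox 0 T)) g"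
    and zero: "\<And>T. (LINT u|lebesgue_on (cbox 0 T). g u) = 0"
  shows "AE u in lebesgue. u \<in> orthant \<longrightarrow> g u = 0"
proof -
  have box: "AE u in lebesgue_on (cbox 0 T). g u = 0" for T
  proof -
    define M where "M = lebesgue_on (cbox 0 T)"
    have gM: "integrable M g" and space: "space M = cbox 0 T" using int by (simp_all add: M_def)
    have meas: "B \<inter> cbox 0 T \<in> sets M" if "B \<in> sets borel" for B
      unfolding M_def sets_restrict_space using that by (intro image_eqI[of _ _ B]) auto
    have integ: "integrable M (\<lambda>u. indicator B u *\<^sub>R g u)" if "B \<in> sets borel" for B
    proof -
      have "integrable M (\<lambda>u. indicator (B \<inter> cbox 0 T) u *\<^sub>R g u)"
        by (intro integrable_mult_indicator meas that gM)
      also have "?this \<longleftrightarrow> integrable M (\<lambda>u. indicator B u *\<^sub>R g u)"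
        by (intro Bochner_Integration.integrable_cong) (auto simp: space indicator_def)
      finally show ?thesis .
    qed
    have borel: "(LINT u|M. indicator A u *\<^sub>R g u) = 0" if "A \<in> sets borel" for A
    proof -
      have A: "A \<in> sigma_sets UNIV (range (\<lambda>a::real^'n. {..a}))"
        using that by (simp add: borel_eq_atMost)
      have ss: "sigma_sets UNIV (range (\<lambda>a::real^'n. {..a})) = sets borel"
        by (simp add: borel_eq_atMost)
      have stable: "Int_stable (range (\<lambda>a::real^'n. {..a}))"
      proof (rule Int_stableI)
        fix A B :: "(real^'n) set" assume "A \<in> range (\<lambda>a. {..a})" "B \<in> range (\<lambda>a. {..a})"
        then obtain a b where "A = {..a}" "B = {..b}" by auto
        then have "A \<inter> B = {..inf a b}" by auto
        then show "A \<inter> B \<in> range (\<lambda>a. {..a})" by auto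
      qed
      show ?thesis
      proof (rule sigma_sets_induct_disjoint[OF stable _ A,
            where P = "\<lambda>A. (LINT u|M. indicator A u *\<^sub>R g u) = 0"])
        fix A assume "A \<in> range (\<lambda>a::real^'n. {..a})"
        then obtain a where "A = {..a}" by auto
        then have "(LINT u|M. indicator A u *\<^sub>R g u) = (LINT u|M. (if u \<le> a then g u else 0))"
          by (intro Bochner_Integration.integral_cong) (auto simp: indicator_def)
        also have "\<dots> = 0" unfolding M_def integral_lebesgue_on_cbox_restrict by (rule zero)
        finally show "(LINT u|M. indicator A u *\<^sub>R g u) = 0" .
      next
        fix A assume A: "A \<in> sigma_sets UNIV (range (\<lambda>a::real^'n. {..a}))"
          and 0: "(LINT u|M. indicator A u *\<^sub>R g u) = 0"
        have "(LINT u|M. indicator (UNIV - A) u *\<^sub>R g u) = (LINT u|M. g u - indicator A u *\<^sub>R g u)"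
          by (intro Bochner_Integration.integral_cong) (auto simp: indicator_def)
        also have "\<dots> = (LINT u|M. g u) - (LINT u|M. indicator A u *\<^sub>R g u)"
          using A by (intro Bochner_Integration.integral_diff gM integ) (simp add: ss)
        finally show "(LINT u|M. indicator (UNIV - A) u *\<^sub>R g u) = 0"
          using 0 zero by (simp add: M_def)
      next
        fix A :: "nat \<Rightarrow> (real^'n) set" assume dis: "disjoint_family A"
          and A: "range A \<subseteq> sigma_sets UNIV (range (\<lambda>a::real^'n. {..a}))"
          and 0: "\<And>i. (LINT u|M. indicator (A i) u *\<^sub>R g u) = 0"
        have AM: "A i \<inter> cbox 0 T \<in> sets M" for i using A by (intro meas) (auto simp: ss)
        have dis': "disjoint_family (\<lambda>i. A i \<inter> cbox 0 T)"
          using dis by (auto simp: disjoint_family_on_def)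
        have restr: "(LINT u|M. indicator (B \<inter> cbox 0 T) u *\<^sub>R g u) = (LINT u|M. indicator B u *\<^sub>R g u)" for B
          by (intro Bochner_Integration.integral_cong) (auto simp: indicator_def space)
        have "(LINT u:(\<Union>i. A i \<inter> cbox 0 T)|M. g u) = (\<Sum>i. LINT u:(A i \<inter> cbox 0 T)|M. g u)"
        proof (rule lebesgue_integral_countable_add)
          show "set_integrable M (\<Union>i. A i \<inter> cbox 0 T) g"
            unfolding set_integrable_def
            by (intro integrable_mult_indicator gM sets.countable_UN image_subsetI AM)
        qed (use AM dis' in \<open>auto simp: disjoint_family_on_def\<close>)
        also have "\<dots> = 0" using 0 by (simp add: set_lebesgue_integral_def restr)
        finally show "(LINT u|M. indicator (\<Union> (range A)) u *\<^sub>R g u) = 0"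
          using restr[of "\<Union> (range A)"] by (simp add: set_lebesgue_integral_def)
      qed auto
    qed
    interpret finite_measure M
      unfolding M_def by (intro finite_measure_lebesgue_on) auto
    have "AE u in M. g u = 0"
    proof (rule density_zero[OF gM])
      fix A assume "A \<in> sets M"
      then obtain B where B: "B \<in> sets lebesgue" "A = B \<inter> cbox 0 T"
        by (auto simp: M_def sets_restrict_space)
      \<comment> \<open>\<open>density_zero\<close> asks for all sets of the completed measure; the
        main part is a Borel set that differs from \<open>B\<close> by a null set only.\<close>
      then have "AE u in lborel. u \<in> main_part lborel B \<longleftrightarrow> u \<in> B"
        by (intro AE_in_main_part) simp
      then have "AE u in lebesgue. u \<in> main_part lborel B \<longleftrightarrow> u \<in> B" by (rule AE_completion)
      then have "AE u in M. u \<in> main_part lborel B \<longleftrightarrow> u \<in> B"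
        unfolding M_def by (subst AE_restrict_space_iff) auto
      then have "AE u in M. indicator A u *\<^sub>R g u = indicator (main_part lborel B) u *\<^sub>R g u"
        using AE_space by eventually_elim (auto simp: indicator_def B space)
      moreover have mp: "main_part lborel B \<in> sets borel" using main_part_sets[OF B(1)] by (simp only: sets_lborel)
      moreover have "(\<lambda>u. indicator (main_part lborel B) u *\<^sub>R g u) \<in> borel_measurable M"
        by (intro borel_measurable_integrable integ mp)
      moreover have "(\<lambda>u. indicator A u *\<^sub>R g u) \<in> borel_measurable M"
        using gM \<open>A \<in> sets M\<close> by (intro borel_measurable_scaleR borel_measurable_indicator) auto
      ultimately have "(LINT u|M. indicator A u *\<^sub>R g u)
          = (LINT u|M. indicator (main_part lborel B) u *\<^sub>R g u)"
        by (intro integral_cong_AE)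
      also have "\<dots> = 0" by (rule borel[OF mp])
      finally show "set_lebesgue_integral M A g = 0" by (simp add: set_lebesgue_integral_def)
    qed
    then show ?thesis unfolding M_def .
  qed
  show ?thesis by (rule AE_orthant_if_AE_boxes[OF box])
qed

section \<open>Vanishing moments in the variables exp(-s_j)\<close>

text \<open>These are the polynomial moments after the substitution x_j = exp(-s_j), which maps the
  orthant into the unit cube. Support in the orthant keeps the monomials bounded, and making the
  condition a predicate on \<open>w\<close> lets polynomial factors be absorbed into
  \<open>w\<close>.\<close>

definition moments_vanish :: "(real^'n \<Rightarrow> complex) \<Rightarrow> bool" where
  "moments_vanish w \<longleftrightarrow> integrable lborel w \<and> (\<forall>s. s \<notin> orthant \<longrightarrow> w s = 0) \<and>
     (\<forall>m :: 'n \<Rightarrow> nat. (LINT s|lborel. of_real (\<Prod>j\<in>UNIV. exp (- s $ j) ^ m j) * w s) = 0)"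

lemma integrable_bounded_mult_orthant:
  fixes c :: "real^'n \<Rightarrow> real" and w :: "real^'n \<Rightarrow> complex"
  assumes "integrable lborel w" "c \<in> borel_measurable borel"
    and "\<And>s. s \<in> orthant \<Longrightarrow> \<bar>c s\<bar> \<le> B" and "\<And>s. s \<notin> orthant \<Longrightarrow> w s = 0"
  shows "integrable lborel (\<lambda>s. of_real (c s) * w s)"
proof (rule Bochner_Integration.integrable_bound)
  show "integrable lborel (\<lambda>s. B * norm (w s))" using assms(1) by simp
  show "(\<lambda>s. of_real (c s) * w s) \<in> borel_measurable lborel"
    using assms(2) borel_measurable_integrable[OF assms(1)] by simp
  show "AE s in lborel. norm (of_real (c s) * w s) \<le> norm (B * norm (w s))"
  proof (rule AE_I2)
    fix s
    show "norm (of_real (c s) * w s) \<le> norm (B * norm (w s))"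
    proof (cases "s \<in> orthant")
      case True
      with assms(3) have "\<bar>c s\<bar> \<le> \<bar>B\<bar>" by force
      then show ?thesis by (simp add: norm_mult abs_mult mult_right_mono)
    qed (simp add: assms(4))
  qed
qed

lemma moment_factor_bound:
  assumes "s \<in> orthant"
  shows "\<bar>\<Prod>j\<in>UNIV. exp (- s $ j) ^ m j\<bar> \<le> (1::real)"
proof -
  have "(\<Prod>j\<in>UNIV. exp (- s $ j) ^ m j) \<le> (1::real)"
    using assms by (intro prod_le_1) (auto simp: orthant_def power_le_one)
  moreover have "0 \<le> (\<Prod>j\<in>UNIV. exp (- s $ j) ^ m j :: real)" by (intro prod_nonneg) auto
  ultimately show ?thesis by simp
qed

lemma integrable_moment:
  fixes w :: "real^'n \<Rightarrow> complex"
  assumes "moments_vanish w"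
  shows "integrable lborel (\<lambda>s. of_real (\<Prod>j\<in>UNIV. exp (- s $ j) ^ m j) * w s)"
proof (rule integrable_bounded_mult_orthant[OF _ _ moment_factor_bound])
  show "(\<lambda>s::real^'n. \<Prod>j\<in>UNIV. exp (- s $ j) ^ m j) \<in> borel_measurable borel" by measurable
qed (use assms in \<open>auto simp: moments_vanish_def\<close>)

lemma moments_vanish_add:
  assumes "moments_vanish v" "moments_vanish w"
  shows "moments_vanish (\<lambda>s. v s + w s)"
  using assms integrable_moment[OF assms(1)] integrable_moment[OF assms(2)]
  unfolding moments_vanish_def by (simp add: distrib_left)

lemma moments_vanish_mult:
  assumes "moments_vanish w"
  shows "moments_vanish (\<lambda>s. c * w s)"
  using assms unfolding moments_vanish_def by (simp add: mult.left_commute[of _ c])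

lemma moments_vanish_sum:
  assumes "finite J" "\<And>j. j \<in> J \<Longrightarrow> moments_vanish (w j)"
  shows "moments_vanish (\<lambda>s. \<Sum>j\<in>J. w j s)"
  using assms by (induction J) (auto intro: moments_vanish_add simp: moments_vanish_def[of "\<lambda>_. 0"])

text \<open>The new factor raises the exponent \<open>m i\<close> by one, and the hypothesis covers
  all exponents.\<close>

lemma moments_vanish_mult_exp:
  fixes w :: "real^'n \<Rightarrow> complex"
  assumes w: "moments_vanish w"
  shows "moments_vanish (\<lambda>s. of_real (exp (- s $ i)) * w s)"
  unfolding moments_vanish_def
proof (intro conjI allI impI)
  show "integrable lborel (\<lambda>s. of_real (exp (- s $ i)) * w s)"
    by (rule integrable_bounded_mult_orthant[where B = 1])
      (use w in \<open>simp_all add: moments_vanish_def orthant_def\<close>)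
  show "of_real (exp (- s $ i)) * w s = 0" if "s \<notin> orthant" for s
    using w that by (simp add: moments_vanish_def)
  fix m :: "'n \<Rightarrow> nat"
  have prod_eq: "(\<Prod>j\<in>UNIV. exp (- s $ j) ^ m j) * exp (- s $ i)
      = (\<Prod>j\<in>UNIV. exp (- s $ j) ^ (m(i := Suc (m i))) j)" for s :: "real^'n"
  proof -
    have "(\<Prod>j\<in>UNIV. exp (- s $ j) ^ (m(i := Suc (m i))) j)
        = (\<Prod>j\<in>UNIV. exp (- s $ j) ^ m j * (if j = i then exp (- s $ j) else 1))"
    proof (rule prod.cong[OF refl])
      show "exp (- s $ j) ^ (m(i := Suc (m i))) j = exp (- s $ j) ^ m j * (if j = i then exp (- s $ j) else 1)" for j
        by (cases "j = i") (simp_all only: fun_upd_apply if_True if_False refl power_Suc2 mult_1_right)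
    qed
    then show ?thesis by (simp only: prod.distrib prod.delta finite UNIV_I if_True)
  qed
  then have "of_real (\<Prod>j\<in>UNIV. exp (- s $ j) ^ m j) * (of_real (exp (- s $ i)) * w s)
      = of_real (\<Prod>j\<in>UNIV. exp (- s $ j) ^ (m(i := Suc (m i))) j) * w s" for s
    by (simp only: of_real_mult mult.assoc flip: prod_eq)
  moreover have "(LINT s|lborel. of_real (\<Prod>j\<in>UNIV. exp (- s $ j) ^ (m(i := Suc (m i))) j) * w s) = 0"
    using w unfolding moments_vanish_def by blast
  ultimately show "(LINT s|lborel. of_real (\<Prod>j\<in>UNIV. exp (- s $ j) ^ m j)
      * (of_real (exp (- s $ i)) * w s)) = 0"
    by (simp only:)
qed

text \<open>The claim is about all \<open>w\<close> at once, so that products of polynomials are handled by applying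
  the induction hypotheses one after the other.\<close>

lemma moments_vanish_mult_polynomial:
  fixes q :: "real^'n \<Rightarrow> real"
  assumes "real_polynomial_function q" "moments_vanish w"
  shows "moments_vanish (\<lambda>s. of_real (q (\<chi> j. exp (- s $ j))) * w s)"
  using assms
proof (induction q arbitrary: w)
  case (linear q)
  interpret bounded_linear q by fact
  \<comment> \<open>The linear generators of polynomial functions are arbitrary bounded linear maps,
    so they are first expanded in coordinates.\<close>
  have "q x = (\<Sum>j\<in>UNIV. q (axis j 1) * x $ j)" for x :: "real^'n"
  proof -
    have "q x = q (\<Sum>j\<in>UNIV. x $ j *\<^sub>R axis j 1)"
      using basis_expansion[of x] by (simp only: scalar_mult_eq_scaleR)
    then show ?thesis by (simp only: sum scaleR real_scaleR_def mult.commute)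
  qed
  from this[of "\<chi> j. exp (- s $ j)" for s]
  have "(\<lambda>s. of_real (q (\<chi> j. exp (- s $ j))) * w s)
      = (\<lambda>s. \<Sum>j\<in>UNIV. of_real (q (axis j 1)) * (of_real (exp (- s $ j)) * w s))"
    by (simp only: of_real_sum of_real_mult sum_distrib_right mult.assoc vec_lambda_beta)
  then show ?case
    by (simp only:) (intro moments_vanish_sum moments_vanish_mult moments_vanish_mult_exp \<open>moments_vanish w\<close> finite)
next
  case (const c)
  then show ?case by (intro moments_vanish_mult)
next
  case (add f g)
  then show ?case using moments_vanish_add[OF add.IH[OF add.prems]] by (simp add: distrib_right)
next
  case (mult f g)
  then show ?case using mult.IH(1)[OF mult.IH(2)[OF mult.prems]] by (simp add: mult.assoc)
qed

text \<open>On the orthant the substituted variables stay in the compact cube, where polynomials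
  approximate \<open>\<phi>\<close> uniformly; the error is controlled by the integral of
  |w|.\<close>

lemma integral_continuous_exp_zero:
  fixes \<phi> :: "real^'n \<Rightarrow> real"
  assumes w: "moments_vanish w" and \<phi>: "continuous_on UNIV \<phi>"
  shows "(LINT s|lborel. of_real (\<phi> (\<chi> j. exp (- s $ j))) * w s) = 0"
proof -
  define X where "X = (\<lambda>s::real^'n. \<chi> j. exp (- s $ j))"
  have wi: "integrable lborel w" and w0: "\<And>s. s \<notin> orthant \<Longrightarrow> w s = 0"
    using w by (auto simp: moments_vanish_def)
  have X: "X s \<in> cbox 0 1" if "s \<in> orthant" for s
    using that by (auto simp: X_def mem_box_cart orthant_def)
  have Xc: "continuous_on UNIV X"
    unfolding X_def by (intro continuous_intros)
  have int: "integrable lborel (\<lambda>s. of_real (\<psi> (X s)) * w s)"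
    if "continuous_on UNIV \<psi>" for \<psi> :: "real^'n \<Rightarrow> real"
  proof -
    have "compact (\<psi> ` cbox 0 1)"
      using that by (intro compact_continuous_image compact_cbox) (auto intro: continuous_on_subset)
    then obtain B where B: "\<And>x. x \<in> cbox 0 1 \<Longrightarrow> \<bar>\<psi> x\<bar> \<le> B"
      by (force dest!: compact_imp_bounded simp: bounded_iff)
    show ?thesis
    proof (rule integrable_bounded_mult_orthant[OF wi])
      have "continuous_on UNIV (\<lambda>s. \<psi> (X s))"
        using continuous_on_compose2[OF that Xc] by simp
      then show "(\<lambda>s. \<psi> (X s)) \<in> borel_measurable borel"
        by (rule borel_measurable_continuous_onI)
    qed (use B X w0 in auto)
  qed
  have "cmod (LINT s|lborel. of_real (\<phi> (X s)) * w s) \<le> 0 + e" if e: "0 < e" for e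
  proof -
    \<comment> \<open>The summand 1 keeps the denominator positive even if \<open>w\<close> vanishes
      almost everywhere.\<close>
    define d where "d = e / (1 + (LINT s|lborel. cmod (w s)))"
    have pos: "0 < 1 + (LINT s|lborel. cmod (w s))"
      by (simp add: add_pos_nonneg)
    have d: "0 < d" using e pos by (simp add: d_def)
    obtain q where q: "real_polynomial_function q" "\<And>x. x \<in> cbox 0 1 \<Longrightarrow> \<bar>\<phi> x - q x\<bar> < d"
      using Stone_Weierstrass_real_polynomial_function[OF compact_cbox _ d, of 0 1 \<phi>] \<phi>
      by (metis continuous_on_subset subset_UNIV)
    have qc: "continuous_on UNIV q"
      using q(1) continuous_on_polymonial_function real_polynomial_function_eq by blast
    \<comment> \<open>The moment with all exponents 0 is the plain integral.\<close>
    have "(LINT s|lborel. of_real (q (X s)) * w s) = 0"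
      using moments_vanish_mult_polynomial[OF q(1) w]
      unfolding moments_vanish_def X_def by (auto dest!: spec[of _ "\<lambda>_. 0"])
    then have "(LINT s|lborel. of_real (\<phi> (X s)) * w s)
        = (LINT s|lborel. of_real (\<phi> (X s)) * w s - of_real (q (X s)) * w s)"
      by (simp add: int \<phi> qc)
    also have "cmod \<dots> \<le> (LINT s|lborel. d * cmod (w s))"
    proof (rule order_trans[OF integral_norm_bound integral_mono])
      fix s
      show "cmod (of_real (\<phi> (X s)) * w s - of_real (q (X s)) * w s) \<le> d * cmod (w s)"
      proof (cases "s \<in> orthant")
        case True
        have "of_real (\<phi> (X s)) * w s - of_real (q (X s)) * w s = of_real (\<phi> (X s) - q (X s)) * w s"
          by (simp add: algebra_simps)
        then show ?thesis using q(2)[OF X[OF True]]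
          by (metis mult_right_mono norm_ge_zero norm_mult norm_of_real less_imp_le)
      qed (simp add: w0)
    qed (use wi int \<phi> qc in auto)
    also have "\<dots> = d * (LINT s|lborel. cmod (w s))" by simp
    also have "\<dots> \<le> e" using e pos by (simp add: d_def field_simps)
    finally show ?thesis by simp
  qed
  then have "cmod (LINT s|lborel. of_real (\<phi> (X s)) * w s) \<le> 0" by (rule field_le_epsilon)
  then show ?thesis by (simp add: X_def)
qed

text \<open>The indicator of s \<le> t is a bounded pointwise limit of continuous functions of the
  variables exp(-s_j), so \<open>w\<close> has integral 0 over every such set, and the lemma on box
  integrals applies.\<close>

lemma moments_vanish_imp_AE_zero:
  fixes w :: "real^'n \<Rightarrow> complex"
  assumes w: "moments_vanish w"
  shows "AE s in lebesgue. w s = 0"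
proof -
  have wi: "integrable lborel w" and w0: "\<And>s. s \<notin> orthant \<Longrightarrow> w s = 0"
    using w by (auto simp: moments_vanish_def)
  have [measurable]: "w \<in> borel_measurable borel" using borel_measurable_integrable[OF wi] by simp
  have zero: "(LINT s|lborel. (if s \<le> t then w s else 0)) = 0" for t
  proof -
    \<comment> \<open>A product of ramps: the factor for \<open>j\<close> is 1 if s_j \<le> t_j and,
      for m > 0, it is 0 once exp(-s_j) has dropped by 1/m below exp(-t_j).\<close>
    define c where "c = (\<lambda>m s. \<Prod>j\<in>UNIV. max 0 (min 1 (1 + real m * (exp (- s $ j) - exp (- t $ j)))))"
    have c01: "0 \<le> c m s" "c m s \<le> 1" for m and s :: "real^'n"
      unfolding c_def by (auto intro!: prod_nonneg prod_le_1)
    have "(\<lambda>m. LINT s|lborel. of_real (c m s) * w s) \<longlonglongrightarrow> (LINT s|lborel. (if s \<le> t then w s else 0))"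
    proof (rule integral_dominated_convergence[where w = "\<lambda>s. cmod (w s)"])
      show "(\<lambda>s. of_real (c m s) * w s) \<in> borel_measurable lborel" for m
        unfolding c_def by measurable
      show "AE s in lborel. cmod (of_real (c m s) * w s) \<le> cmod (w s)" for m
        using c01 by (auto simp: norm_mult mult_left_le_one_le)
      show "AE s in lborel. (\<lambda>m. of_real (c m s) * w s) \<longlonglongrightarrow> (if s \<le> t then w s else 0)"
      proof (rule AE_I2)
        fix s
        have "(\<lambda>m. max 0 (min 1 (1 + real m * (exp (- s $ j) - exp (- t $ j)))))
            \<longlonglongrightarrow> (if s $ j \<le> t $ j then 1 else 0)" for j
        proof (cases "s $ j \<le> t $ j")
          case True
          then have "max 0 (min 1 (1 + real m * (exp (- s $ j) - exp (- t $ j)))) = 1" for m by simp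
          with True show ?thesis by simp
        next
          case False
          then have "exp (- s $ j) - exp (- t $ j) < 0" by simp
          then have "filterlim (\<lambda>m. 1 + real m * (exp (- s $ j) - exp (- t $ j))) at_bot sequentially"
            by real_asymp
          then have "eventually (\<lambda>m. 1 + real m * (exp (- s $ j) - exp (- t $ j)) \<le> 0) sequentially"
            by (simp add: filterlim_at_bot)
          then have "eventually (\<lambda>m. max 0 (min 1 (1 + real m * (exp (- s $ j) - exp (- t $ j)))) = 0) sequentially"
            by eventually_elim simp
          with False show ?thesis by (simp add: tendsto_eventually)
        qed
        then have "(\<lambda>m. c m s) \<longlonglongrightarrow> (\<Prod>j\<in>UNIV. if s $ j \<le> t $ j then 1 else 0)"
          unfolding c_def by (intro tendsto_prod)
        also have "(\<Prod>j\<in>UNIV. if s $ j \<le> t $ j then 1 else 0) = (if s \<le> t then 1 else 0 :: real)"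
          by (auto simp: less_eq_vec_def)
        finally have "(\<lambda>m. of_real (c m s) * w s) \<longlonglongrightarrow> of_real (if s \<le> t then 1 else 0) * w s"
          by (intro tendsto_intros)
        then show "(\<lambda>m. of_real (c m s) * w s) \<longlonglongrightarrow> (if s \<le> t then w s else 0)"
          by (simp split: if_splits)
      qed
    qed (use wi in auto)
    moreover have "(LINT s|lborel. of_real (c m s) * w s) = 0" for m
    proof -
      have "continuous_on UNIV (\<lambda>x::real^'n. \<Prod>j\<in>UNIV. max 0 (min 1 (1 + real m * (x $ j - exp (- t $ j)))))"
        by (intro continuous_intros)
      from integral_continuous_exp_zero[OF w this] show ?thesis by (simp add: c_def)
    qed
    ultimately show ?thesis by (simp add: LIMSEQ_const_iff)
  qed
  have wl: "integrable lebesgue w" using wi by (simp add: integrable_completion)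
  have "AE s in lebesgue. s \<in> orthant \<longrightarrow> w s = 0"
  proof (rule zero_on_boxes_imp_AE_zero)
    fix T :: "real^'n"
    show "integrable (lebesgue_on (cbox 0 T)) w"
      by (subst integrable_restrict_space) (auto intro!: integrable_mult_indicator wl)
    have "(LINT s|lebesgue_on (cbox 0 T). w s) = (LINT s|lebesgue. indicator (cbox 0 T) s *\<^sub>R w s)"
      by (subst integral_restrict_space) auto
    \<comment> \<open>The box and the lower set of \<open>T\<close> differ only outside the orthant,
      where \<open>w\<close> is 0.\<close>
    also have "\<dots> = (LINT s|lebesgue. (if s \<le> T then w s else 0))"
      by (rule Bochner_Integration.integral_cong[OF refl])
        (use w0 in \<open>auto simp: indicator_def less_eq_vec_def mem_box_cart orthant_def\<close>)
    also have "\<dots> = (LINT s|lborel. (if s \<le> T then w s else 0))"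
      by (rule integral_completion) measurable
    finally show "(LINT s|lebesgue_on (cbox 0 T). w s) = 0" using zero by simp
  qed
  then show ?thesis by eventually_elim (use w0 in blast)
qed

section \<open>Uniqueness for scalar functions\<close>

lemma integrable_continuous_mult_cbox:
  fixes e h :: "real^'n \<Rightarrow> complex"
  assumes e: "continuous_on UNIV e" and h: "integrable (lebesgue_on (cbox a b)) h"
  shows "integrable (lebesgue_on (cbox a b)) (\<lambda>u. e u * h u)"
proof -
  have "compact (e ` cbox a b)"
    using e by (intro compact_continuous_image compact_cbox) (auto intro: continuous_on_subset)
  then obtain B where B: "\<And>x. x \<in> cbox a b \<Longrightarrow> cmod (e x) \<le> B"
    by (force dest!: compact_imp_bounded simp: bounded_iff)
  have em: "e \<in> borel_measurable (lebesgue_on (cbox a b))"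
    using measurable_compose[OF measurable_lebesgue_on_borel borel_measurable_continuous_onI[OF e]] .
  show ?thesis
  proof (rule Bochner_Integration.integrable_bound)
    show "integrable (lebesgue_on (cbox a b)) (\<lambda>u. B * cmod (h u))" using h by simp
    show "(\<lambda>u. e u * h u) \<in> borel_measurable (lebesgue_on (cbox a b))"
      using em borel_measurable_integrable[OF h] by simp
    show "AE u in lebesgue_on (cbox a b). norm (e u * h u) \<le> norm (B * cmod (h u))"
    proof (rule AE_I2)
      fix u assume "u \<in> space (lebesgue_on (cbox a b))"
      then have "cmod (e u) \<le> \<bar>B\<bar>" using B[of u] by simp
      then show "norm (e u * h u) \<le> norm (B * cmod (h u))"
        by (simp add: norm_mult abs_mult mult_right_mono)
    qed
  qed
qed

text \<open>A limit along growing cubes suffices, since it only serves to identify the integral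
  against \<open>H\<close> after dominated convergence; every point eventually lies below the upper
  corner of the cube.\<close>

lemma laplace_transform_unique_scalar:
  fixes h :: "real^'n \<Rightarrow> complex" and l0 :: "complex^'n" and a :: "real^'n"
  assumes h: "\<And>T. integrable (lebesgue_on (cbox 0 T)) h"
    and bdd: "\<And>t. t \<in> orthant \<Longrightarrow> cmod (LINT u|lebesgue_on (cbox 0 t). laplace_kernel l0 u * h u) \<le> B"
    and a: "\<And>j. Re (l0 $ j) < a $ j"
    and lim: "\<And>l :: real^'n. (\<And>j. a $ j < l $ j) \<Longrightarrow>
      (\<lambda>i. LINT u|lebesgue_on (cbox 0 (\<chi> j. real i)). laplace_kernel (\<chi> j. of_real (l $ j)) u * h u)
         \<longlonglongrightarrow> 0"
  shows "AE u in lebesgue. u \<in> orthant \<longrightarrow> h u = 0"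
proof -
  define k where "k = (\<lambda>u. laplace_kernel l0 u * h u)"
  define H where "H = (\<lambda>t. LINT u|lebesgue_on (cbox 0 t). k u)"
  define T where "T = (\<lambda>i::nat. (\<chi> j. real i) :: real^'n)"
  have k: "integrable (lebesgue_on (cbox 0 t)) k" for t
    unfolding k_def by (intro integrable_continuous_mult_cbox continuous_laplace_kernel h)
  have H0: "H t = 0" if "t \<notin> orthant" for t
  proof -
    from that obtain j where "t $ j < 0" by (auto simp: orthant_def not_le)
    then have "cbox 0 t = {}" by (auto simp: interval_eq_empty_cart)
    then show ?thesis unfolding H_def by (intro Bochner_Integration.integral_empty) simp
  qed
  have B: "0 \<le> B"
    using order_trans[OF norm_ge_zero bdd[of 0]] by (simp add: orthant_def)
  have H_bdd: "cmod (H t) \<le> B" for t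
    using bdd[of t] H0[of t] B by (cases "t \<in> orthant") (auto simp: H_def k_def)
  have T_ev: "eventually (\<lambda>i. inf s (T i) = s) sequentially" for s
  proof -
    have "eventually (\<lambda>i. s $ j \<le> real i) sequentially" for j
      using filterlim_real_sequentially by (auto simp: filterlim_at_top)
    then have "eventually (\<lambda>i. \<forall>j. s $ j \<le> real i) sequentially"
      by (simp add: eventually_all_finite)
    then show ?thesis
      by eventually_elim (auto simp: T_def less_eq_vec_def intro!: inf_absorb1)
  qed
  have H_lim: "(\<lambda>i. H (inf s (T i))) \<longlonglongrightarrow> H s" for s
    by (rule tendsto_eventually) (use T_ev[of s] in eventually_elim, simp)
  \<comment> \<open>The measurability claim is stated together with the integration by parts and
    asks for some exponent with positive real parts; 1 is such a vector.\<close>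
  have HT_meas [measurable]: "(\<lambda>s. H (inf s (T i))) \<in> borel_measurable borel" for i
    unfolding H_def by (rule borel_measurable_box_integral[of 1]) (auto intro: k)
  have H_meas [measurable]: "H \<in> borel_measurable borel"
    by (rule borel_measurable_LIMSEQ_metric[OF HT_meas H_lim])
  \<comment> \<open>Used with t = s and with t = inf s T. The cut-off to 0 \<le> s makes the
    majorant integrable; it is legitimate because elsewhere \<open>t\<close> leaves the orthant and
    \<open>H t = 0\<close>.\<close>
  have dom: "cmod (laplace_kernel \<mu> s * H t) \<le> B * cmod (if 0 \<le> s then laplace_kernel \<mu> s else 0)"
    if "t \<le> s" for \<mu> s t
  proof (cases "0 \<le> s")
    case True
    then show ?thesis using H_bdd[of t] by (simp add: norm_mult mult.commute mult_right_mono)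
  next
    case False
    then have "t \<notin> orthant"
      using that by (auto simp: less_eq_vec_def orthant_def intro: order_trans)
    with False H0 show ?thesis by simp
  qed
  \<comment> \<open>The summand 1 moves the point strictly beyond \<open>a\<close>, where the
    transform vanishes. \<open>l0\<close> is subtracted because \<open>k\<close> already contains
    the kernel at \<open>l0\<close>. Integer steps \<open>m j\<close> multiply the kernel by powers
    of exp(-s_j).\<close>
  define \<mu> where "\<mu> = (\<lambda>m::'n \<Rightarrow> nat. (\<chi> j. of_real (a $ j + 1 + real (m j)) - l0 $ j) :: complex^'n)"
  have \<mu>: "0 < Re (\<mu> m $ j)" for m j using a[of j] by (simp add: \<mu>_def)
  have domi: "integrable lborel (\<lambda>s. B * cmod (if 0 \<le> s then laplace_kernel (\<mu> m) s else 0))" for m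
    by (intro integrable_mult_right integrable_norm integrable_laplace_kernel \<mu>)
  have zero: "(LINT s|lborel. laplace_kernel (\<mu> m) s * H s) = 0" for m
  proof -
    define l :: "real^'n" where "l = (\<chi> j. a $ j + 1 + real (m j))"
    have "laplace_kernel (\<mu> m) u * k u = laplace_kernel (\<chi> j. of_real (l $ j)) u * h u" for u
    proof -
      have "(\<chi> j. of_real (l $ j)) = \<mu> m + l0" by (simp add: vec_eq_iff l_def \<mu>_def)
      then show ?thesis by (simp add: k_def laplace_kernel_add)
    qed
    then have "(\<Prod>j\<in>UNIV. \<mu> m $ j) * (LINT s|lborel. laplace_kernel (\<mu> m) s * H (inf s (T i)))
        = (LINT u|lebesgue_on (cbox 0 (T i)). laplace_kernel (\<chi> j. of_real (l $ j)) u * h u)" for i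
      using laplace_integration_by_parts[OF \<mu>[of m] k[of "T i"]] by (simp add: H_def)
    then have "(\<lambda>i. (\<Prod>j\<in>UNIV. \<mu> m $ j) * (LINT s|lborel. laplace_kernel (\<mu> m) s * H (inf s (T i)))) \<longlonglongrightarrow> 0"
      using lim[of l] by (simp add: l_def T_def)
    moreover have "(\<lambda>i. LINT s|lborel. laplace_kernel (\<mu> m) s * H (inf s (T i)))
        \<longlonglongrightarrow> (LINT s|lborel. laplace_kernel (\<mu> m) s * H s)"
    proof (rule integral_dominated_convergence[OF _ _ domi[of m]])
      show "AE s in lborel. cmod (laplace_kernel (\<mu> m) s * H (inf s (T i)))
          \<le> B * cmod (if 0 \<le> s then laplace_kernel (\<mu> m) s else 0)" for i
        by (intro AE_I2 dom inf_le1)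
    qed (auto intro!: tendsto_intros H_lim)
    then have "(\<lambda>i. (\<Prod>j\<in>UNIV. \<mu> m $ j) * (LINT s|lborel. laplace_kernel (\<mu> m) s * H (inf s (T i))))
        \<longlonglongrightarrow> (\<Prod>j\<in>UNIV. \<mu> m $ j) * (LINT s|lborel. laplace_kernel (\<mu> m) s * H s)"
      by (intro tendsto_intros)
    ultimately have "(\<Prod>j\<in>UNIV. \<mu> m $ j) * (LINT s|lborel. laplace_kernel (\<mu> m) s * H s) = 0"
      using LIMSEQ_unique by blast
    moreover have "\<mu> m $ j \<noteq> 0" for j using \<mu>[of m j] by auto
    ultimately show ?thesis by simp
  qed
  have "moments_vanish (\<lambda>s. laplace_kernel (\<mu> (\<lambda>_. 0)) s * H s)"
    unfolding moments_vanish_def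
  proof (intro conjI allI impI)
    show "integrable lborel (\<lambda>s. laplace_kernel (\<mu> (\<lambda>_. 0)) s * H s)"
    proof (rule Bochner_Integration.integrable_bound[OF domi[of "\<lambda>_. 0"]])
      show "AE s in lborel. cmod (laplace_kernel (\<mu> (\<lambda>_. 0)) s * H s)
          \<le> norm (B * cmod (if 0 \<le> s then laplace_kernel (\<mu> (\<lambda>_. 0)) s else 0))"
        by (intro AE_I2 order_trans[OF dom[OF order_refl]]) simp
    qed simp
    show "laplace_kernel (\<mu> (\<lambda>_. 0)) s * H s = 0" if "s \<notin> orthant" for s
      using H0[OF that] by simp
    fix m :: "'n \<Rightarrow> nat"
    have "of_real (\<Prod>j\<in>UNIV. exp (- s $ j) ^ m j) * laplace_kernel (\<mu> (\<lambda>_. 0)) s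
        = laplace_kernel (\<mu> m) s" for s
    proof -
      have "complex_of_real (exp (- s $ j) ^ m j) = exp (- of_nat (m j) * of_real (s $ j))" for j
        by (simp add: exp_of_nat_mult[symmetric] flip: exp_of_real)
      then have "of_real (\<Prod>j\<in>UNIV. exp (- s $ j) ^ m j) = laplace_kernel (\<chi> j. of_nat (m j)) s"
        by (simp add: laplace_kernel_prod)
      moreover have "(\<chi> j. of_nat (m j)) + \<mu> (\<lambda>_. 0) = \<mu> m" by (simp add: vec_eq_iff \<mu>_def)
      ultimately show ?thesis by (metis laplace_kernel_add)
    qed
    then show "(LINT s|lborel. of_real (\<Prod>j\<in>UNIV. exp (- s $ j) ^ m j)
        * (laplace_kernel (\<mu> (\<lambda>_. 0)) s * H s)) = 0"
      using zero[of m] by (simp add: mult.assoc[symmetric])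
  qed
  then have "AE s in lebesgue. H s = 0"
    by (auto dest: moments_vanish_imp_AE_zero)
  then have "AE s in lborel. H s = 0"
    by (simp add: AE_completion_iff)
  then obtain N where N: "{s. H s \<noteq> 0} \<subseteq> N" "N \<in> null_sets lborel"
    by (auto simp: eventually_ae_filter)
  \<comment> \<open>From almost everywhere to everywhere: zeros of \<open>H\<close> are chosen in
    ever smaller open boxes with lower corner \<open>t\<close>. Approaching from above matters,
    because the condition u \<le> s(i) then holds for all \<open>i\<close> if u \<le> t and
    eventually fails otherwise.\<close>
  have "H t = 0" for t
  proof -
    define I where "I = (\<lambda>i::nat. (\<chi> j. t $ j + 1 / real (Suc i)) :: real^'n)"
    have "\<exists>s. s \<in> box t (I i) \<and> H s = 0" for i
    proof (rule ccontr)
      assume "\<not> ?thesis"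
      with N(1) have "box t (I i) \<subseteq> N" by auto
      then have "box t (I i) \<in> null_sets lborel"
        using N(2) by (rule null_sets_subset[rotated 2]) auto
      then have "negligible (box t (I i))" by (simp add: negligible_iff_null_sets null_sets_completionI)
      moreover have "box t (I i) \<noteq> {}"
        by (simp add: interval_eq_empty_cart I_def not_le)
      ultimately show False using open_not_negligible[OF open_box] by blast
    qed
    then obtain s where s: "\<And>i. s i \<in> box t (I i)" "\<And>i. H (s i) = 0" by metis
    have s1: "t $ j < s i $ j" "s i $ j < t $ j + 1 / real (Suc i)" for i j
      using s(1)[of i] by (auto simp: mem_box_cart I_def)
    \<comment> \<open>All the points chosen lie below \<open>I 0\<close>, so one box carries all the
      integrals.\<close>
    define M where "M = lebesgue_on (cbox 0 (I 0))"
    have HM: "H v = (LINT u|M. (if u \<le> v then k u else 0))" if "v \<le> I 0" for v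
      using integral_lebesgue_on_cbox_restrict[of "I 0" v k] that
      by (simp add: H_def M_def inf_absorb1)
    have [measurable]: "(\<lambda>u. u) \<in> measurable M borel" "k \<in> borel_measurable M"
      unfolding M_def using measurable_lebesgue_on_borel k by auto
    have "(\<lambda>i. LINT u|M. (if u \<le> s i then k u else 0)) \<longlonglongrightarrow> (LINT u|M. (if u \<le> t then k u else 0))"
    proof (rule integral_dominated_convergence[where w = "\<lambda>u. cmod (k u)"])
      show "integrable M (\<lambda>u. cmod (k u))" unfolding M_def using k by auto
      show "AE u in M. (\<lambda>i. if u \<le> s i then k u else 0) \<longlonglongrightarrow> (if u \<le> t then k u else 0)"
      proof (rule AE_I2)
        fix u
        show "(\<lambda>i. if u \<le> s i then k u else 0) \<longlonglongrightarrow> (if u \<le> t then k u else 0)"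
        proof (cases "u \<le> t")
          case True
          moreover have "t \<le> s i" for i by (simp add: less_eq_vec_def less_imp_le s1(1))
          ultimately have "u \<le> s i" for i by (rule order_trans)
          with True show ?thesis by simp
        next
          case False
          then obtain j where "t $ j < u $ j" by (auto simp: less_eq_vec_def not_le)
          then have "eventually (\<lambda>i. t $ j + 1 / real (Suc i) < u $ j) sequentially"
            by real_asymp
          then have "eventually (\<lambda>i. \<not> u \<le> s i) sequentially"
          proof eventually_elim
            case (elim i)
            then have "s i $ j < u $ j" using s1(2)[of i j] by linarith
            then show ?case by (auto simp: less_eq_vec_def not_le)
          qed
          then have "eventually (\<lambda>i. (if u \<le> s i then k u else 0) = 0) sequentially"
            by eventually_elim simp
          with False show ?thesis by (simp add: tendsto_eventually)
        qed
      qed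
    qed auto
    moreover have "t \<le> I 0" by (simp add: I_def less_eq_vec_def)
    moreover have "s i \<le> I 0" for i
    proof -
      have "s i $ j \<le> t $ j + 1" for j
        using s1(2)[of i j] by (smt (verit) divide_le_eq_1 of_nat_1 of_nat_le_iff le_numeral_extra(4) Suc_le_mono le0 One_nat_def of_nat_Suc of_nat_0_le_iff)
      then show ?thesis by (simp add: I_def less_eq_vec_def)
    qed
    ultimately show ?thesis using s(2) by (simp add: HM[symmetric] LIMSEQ_const_iff)
  qed
  then have "AE u in lebesgue. u \<in> orthant \<longrightarrow> k u = 0"
    using k by (intro zero_on_boxes_imp_AE_zero) (auto simp: H_def)
  then show ?thesis by (simp add: k_def)
qed

section \<open>Integration in locally convex spaces\<close>

text \<open>Fatou's lemma, applied in the second index, turns the mutual closeness of the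
  \<open>s k\<close> into closeness to their pointwise limit.\<close>

lemma
  fixes s :: "nat \<Rightarrow> 'a \<Rightarrow> 'b::{banach, second_countable_topology}"
  assumes f: "f \<in> borel_measurable M" and s: "\<And>k. integrable M (s k)"
    and lim: "AE x in M. (\<lambda>k. s k x) \<longlonglongrightarrow> f x"
    and cauchy: "\<And>e. 0 < e \<Longrightarrow> \<exists>N. \<forall>k\<ge>N. \<forall>l\<ge>N. (LINT x|M. norm (s k x - s l x)) \<le> e"
  shows integrable_L1_Cauchy_limit: "integrable M f"
    and integral_L1_Cauchy_limit: "(\<lambda>k. LINT x|M. s k x) \<longlonglongrightarrow> (LINT x|M. f x)"
proof -
  have [measurable]: "f \<in> borel_measurable M" "s k \<in> borel_measurable M" for k
    using f s by auto
  have "\<exists>N. \<forall>k\<ge>N. (\<integral>\<^sup>+x. norm (f x - s k x) \<partial>M) \<le> ennreal e" if e: "0 < e" for e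
  proof -
    obtain N where N: "\<And>k l. k \<ge> N \<Longrightarrow> l \<ge> N \<Longrightarrow> (LINT x|M. norm (s k x - s l x)) \<le> e"
      using cauchy[OF e] by blast
    have "(\<integral>\<^sup>+x. norm (f x - s k x) \<partial>M) \<le> ennreal e" if k: "k \<ge> N" for k
    proof -
      have "(\<integral>\<^sup>+x. norm (f x - s k x) \<partial>M)
          = (\<integral>\<^sup>+x. liminf (\<lambda>l. ennreal (norm (s l x - s k x))) \<partial>M)"
      proof (rule nn_integral_cong_AE)
        show "AE x in M. ennreal (norm (f x - s k x)) = liminf (\<lambda>l. ennreal (norm (s l x - s k x)))"
          using lim
        proof eventually_elim
          case (elim x)
          then have "(\<lambda>l. ennreal (norm (s l x - s k x))) \<longlonglongrightarrow> ennreal (norm (f x - s k x))"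
            by (intro tendsto_intros)
          then show ?case by (intro lim_imp_Liminf[symmetric]) auto
        qed
      qed
      also have "\<dots> \<le> liminf (\<lambda>l. \<integral>\<^sup>+x. norm (s l x - s k x) \<partial>M)"
        by (rule nn_integral_liminf) measurable
      also have "\<dots> \<le> ennreal e"
      proof (rule Liminf_le)
        have "(\<integral>\<^sup>+x. norm (s l x - s k x) \<partial>M) \<le> ennreal e" if "l \<ge> N" for l
        proof -
          have "(\<integral>\<^sup>+x. norm (s l x - s k x) \<partial>M) = ennreal (LINT x|M. norm (s l x - s k x))"
            by (rule nn_integral_eq_integral) (use s in auto)
          also have "\<dots> \<le> ennreal e" using N[OF that k] by (rule ennreal_leI)
          finally show ?thesis .
        qed
        then show "\<forall>\<^sub>F l in sequentially. (\<integral>\<^sup>+x. norm (s l x - s k x) \<partial>M) \<le> ennreal e"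
          by (auto simp: eventually_sequentially)
      qed simp
      finally show ?thesis .
    qed
    then show ?thesis by blast
  qed
  note close = this
  show fi: "integrable M f"
  proof -
    obtain N where "(\<integral>\<^sup>+x. norm (f x - s N x) \<partial>M) \<le> ennreal 1"
      using close[of 1] by auto
    then have "integrable M (\<lambda>x. f x - s N x)"
      by (intro integrableI_bounded) (auto intro: le_less_trans simp: ennreal_1[symmetric] simp del: ennreal_1)
    from Bochner_Integration.integrable_add[OF this s[of N]] show ?thesis by simp
  qed
  show "(\<lambda>k. LINT x|M. s k x) \<longlonglongrightarrow> (LINT x|M. f x)"
  proof (rule metric_LIMSEQ_I)
    fix e :: real assume e: "0 < e"
    obtain N where N: "\<And>k. k \<ge> N \<Longrightarrow> (\<integral>\<^sup>+x. norm (f x - s k x) \<partial>M) \<le> ennreal (e / 2)"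
      using close[of "e / 2"] e by auto
    have "dist (LINT x|M. s k x) (LINT x|M. f x) < e" if "k \<ge> N" for k
    proof -
      have "ennreal (norm (LINT x|M. f x - s k x)) \<le> (\<integral>\<^sup>+x. norm (f x - s k x) \<partial>M)"
        by (rule integral_norm_bound_ennreal) (use fi s in auto)
      also have "\<dots> \<le> ennreal (e / 2)" using N[OF that] .
      finally have "norm (LINT x|M. f x - s k x) \<le> e / 2"
        using e by (simp add: ennreal_le_iff)
      then show ?thesis using e fi s by (simp add: dist_norm norm_minus_commute)
    qed
    then show "\<exists>N. \<forall>k\<ge>N. dist (LINT x|M. s k x) (LINT x|M. f x) < e" by blast
  qed
qed

text \<open>\<open>lim\<close> gives a function that is measurable everywhere; \<open>F\<close>
  differs from it on a null set, which is harmless since Lebesgue measure is complete.\<close>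

lemma borel_measurable_lebesgue_on_AE_limit:
  fixes F :: "'b::euclidean_space \<Rightarrow> 'c::euclidean_space"
  assumes K: "K \<in> sets lebesgue" and s: "\<And>k. s k \<in> borel_measurable (lebesgue_on K)"
    and lim: "AE t in lebesgue_on K. (\<lambda>k. s k t) \<longlonglongrightarrow> F t"
  shows "F \<in> borel_measurable (lebesgue_on K)"
proof -
  have "(\<lambda>t. lim (\<lambda>k. s k t)) \<in> borel_measurable (lebesgue_on K)"
    using s by (rule borel_measurable_lim_metric)
  then have "(\<lambda>t. indicator K t *\<^sub>R lim (\<lambda>k. s k t)) \<in> borel_measurable lebesgue"
    using K by (subst (asm) borel_measurable_restrict_space_iff) auto
  moreover have "AE t in lebesgue. indicator K t *\<^sub>R lim (\<lambda>k. s k t) = indicator K t *\<^sub>R F t"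
    using lim K by (auto simp: AE_restrict_space_iff indicator_def limI elim!: eventually_mono)
  ultimately have "(\<lambda>t. indicator K t *\<^sub>R F t) \<in> borel_measurable lebesgue"
    by (rule borel_measurable_AE)
  then show ?thesis using K by (subst borel_measurable_restrict_space_iff) auto
qed

text \<open>The range is finite, so any function of a simple function is simple and bounded. This
  serves seminorms and functionals alike.\<close>

lemma (in finite_measure) integrable_simple_function_compose:
  fixes F :: "'c \<Rightarrow> 'b::{banach, second_countable_topology}"
  assumes "simple_function M g"
  shows "integrable M (\<lambda>t. F (g t))"
proof -
  have "finite ((\<lambda>t. norm (F (g t))) ` space M)"
    using simple_function_compose1[OF assms, of "\<lambda>y. norm (F y)"] by (simp add: simple_function_def)
  then obtain B where "\<And>t. t \<in> space M \<Longrightarrow> norm (F (g t)) \<le> B"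
    by (meson Max_ge imageI)
  then show ?thesis
    by (intro integrable_const_bound[where B = B] AE_I2 borel_measurable_simple_function
        simple_function_compose1[OF assms])
qed

text \<open>Real and imaginary parts are rounded down to a grid of mesh 1/(k+1), whence the 2;
  boundedness makes the range finite. Uniform closeness is what controls the products with
  vector-valued simple functions.\<close>

lemma uniform_simple_approximation:
  fixes e :: "'b \<Rightarrow> complex"
  assumes e: "e \<in> borel_measurable M" and B: "\<And>s. s \<in> space M \<Longrightarrow> cmod (e s) \<le> B"
  obtains d :: "nat \<Rightarrow> 'b \<Rightarrow> complex"
  where "\<And>k. simple_function M (d k)" "\<And>k s. cmod (d k s - e s) \<le> 2 / real (Suc k)"
proof -
  define r where "r = (\<lambda>k x. of_int \<lfloor>x * real (Suc k)\<rfloor> / real (Suc k))"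
  have r_close: "\<bar>r k x - x\<bar> \<le> 1 / real (Suc k)" for k x
  proof -
    have "\<bar>of_int \<lfloor>x * real (Suc k)\<rfloor> - x * real (Suc k)\<bar> \<le> 1" by linarith
    moreover have "r k x - x = (of_int \<lfloor>x * real (Suc k)\<rfloor> - x * real (Suc k)) / real (Suc k)"
      by (simp add: r_def diff_divide_distrib del: of_nat_Suc)
    ultimately show ?thesis by (simp add: abs_divide divide_right_mono del: of_nat_Suc)
  qed
  have simple: "simple_function M (\<lambda>s. r k (u s))"
    if [measurable]: "u \<in> borel_measurable M" and u: "\<And>s. s \<in> space M \<Longrightarrow> \<bar>u s\<bar> \<le> B"
    for k and u :: "'b \<Rightarrow> real"
  proof (rule simple_function_borel_measurable)
    show "(\<lambda>s. r k (u s)) \<in> borel_measurable M" unfolding r_def by measurable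
    have "\<lfloor>u s * real (Suc k)\<rfloor> \<in> {\<lfloor>- B * real (Suc k)\<rfloor>..\<lfloor>B * real (Suc k)\<rfloor>}" if "s \<in> space M" for s
      using u[OF that] unfolding atLeastAtMost_iff abs_le_iff
      by (intro conjI floor_mono mult_right_mono) simp_all
    then have "(\<lambda>s. r k (u s)) ` space M
        \<subseteq> (\<lambda>n. of_int n / real (Suc k)) ` {\<lfloor>- B * real (Suc k)\<rfloor>..\<lfloor>B * real (Suc k)\<rfloor>}"
      unfolding r_def by blast
    then show "finite ((\<lambda>s. r k (u s)) ` space M)" by (rule finite_subset) simp
  qed
  show ?thesis
  proof (rule that)
    fix k
    show "simple_function M (\<lambda>s. Complex (r k (Re (e s))) (r k (Im (e s))))"
    proof (rule simple_function_compose2[where h = Complex])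
      show "simple_function M (\<lambda>s. r k (Re (e s)))" "simple_function M (\<lambda>s. r k (Im (e s)))"
        by (rule simple; use e B in \<open>auto intro: order_trans[OF abs_Re_le_cmod] order_trans[OF abs_Im_le_cmod]\<close>)+
    qed
    fix s
    have "cmod (Complex (r k (Re (e s))) (r k (Im (e s))) - e s)
        \<le> \<bar>r k (Re (e s)) - Re (e s)\<bar> + \<bar>r k (Im (e s)) - Im (e s)\<bar>"
      using cmod_le[of "Complex (r k (Re (e s))) (r k (Im (e s))) - e s"] by simp
    also have "\<dots> \<le> 1 / real (Suc k) + 1 / real (Suc k)" by (intro add_mono r_close)
    finally show "cmod (Complex (r k (Re (e s))) (r k (Im (e s))) - e s) \<le> 2 / real (Suc k)" by simp
  qed
qed

definition dominated_functional ::
    "(complex \<Rightarrow> 'a::ab_group_add \<Rightarrow> 'a) \<Rightarrow> ('a \<Rightarrow> real) \<Rightarrow> ('a \<Rightarrow> complex) \<Rightarrow> bool" where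
  "dominated_functional scal p \<phi> \<longleftrightarrow>
     Vector_Spaces.linear scal (*) \<phi> \<and> (\<forall>x. cmod (\<phi> x) \<le> p x)"

section \<open>Seminorms, convergence and dominated functionals\<close>

context sclcs
begin

lemma
  assumes "p \<in> P"
  shows seminorm_add: "p (x + y) \<le> p x + p y"
    and seminorm_scale: "p (scal c x) = cmod c * p x"
    and seminorm_zero: "p 0 = 0"
    and seminorm_nonneg: "0 \<le> p x"
    and seminorm_diff_commute: "p (x - y) = p (y - x)"
    and seminorm_triangle_diff: "p (x - y) \<le> p (x - z) + p (z - y)"
    and seminorm_le_diff: "p x \<le> p (x - y) + p y"
proof -
  have *: "p (x + y) \<le> p x + p y" "p (scal c x) = cmod c * p x" for x y c
    using seminorms[OF assms] by (auto simp: seminorm_def)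
  then show "p (x + y) \<le> p x + p y" "p (scal c x) = cmod c * p x" by auto
  show zero: "p 0 = 0" using *(2)[of 0 0] by simp
  have minus: "p (- x) = p x" for x using *(2)[of "-1" x] by simp
  show "0 \<le> p x" using *(1)[of x "- x"] zero minus[of x] by simp
  show "p (x - y) = p (y - x)" using minus[of "x - y"] by simp
  show "p (x - y) \<le> p (x - z) + p (z - y)" using *(1)[of "x - z" "z - y"] by simp
  show "p x \<le> p (x - y) + p y" using *(1)[of "x - y" y] by simp
qed

lemma open_seminorm_ball:
  assumes p: "p \<in> P"
  shows "open {y. p (y - x) < e}"
  unfolding topology
proof
  fix z assume "z \<in> {y. p (y - x) < e}"
  then have "{y. \<forall>q\<in>{p}. q (y - z) < e - p (z - x)} \<subseteq> {y. p (y - x) < e}"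
    by (auto simp: less_diff_eq intro: le_less_trans[OF seminorm_triangle_diff[OF p, of _ x z]])
  then show "\<exists>F d. finite F \<and> F \<subseteq> P \<and> 0 < d \<and> {y. \<forall>q\<in>F. q (y - z) < d} \<subseteq> {y. p (y - x) < e}"
    using \<open>z \<in> _\<close> p by (intro exI[of _ "{p}"] exI[of _ "e - p (z - x)"]) auto
qed

lemma tendsto_seminorm:
  assumes p: "p \<in> P" and g: "(g \<longlongrightarrow> L) F"
  shows "((\<lambda>k. p (g k - L)) \<longlongrightarrow> 0) F"
proof (rule tendstoI)
  fix e :: real assume "0 < e"
  then have "eventually (\<lambda>k. g k \<in> {y. p (y - L) < e}) F"
    by (intro topological_tendstoD[OF g] open_seminorm_ball[OF p]) (simp add: seminorm_zero[OF p])
  then show "eventually (\<lambda>k. dist (p (g k - L)) 0 < e) F"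
    by eventually_elim (simp add: seminorm_nonneg[OF p])
qed

lemma open_contains_seminorm_ball:
  assumes "open U" "x \<in> U"
  obtains Q e where "finite Q" "Q \<subseteq> P" "0 < e" "{y. \<forall>p\<in>Q. p (y - x) < e} \<subseteq> U"
  using bspec[OF topology[THEN iffD1, OF assms(1)] assms(2)] by (elim exE conjE) (rule that)

lemma tendsto_if_seminorms:
  assumes "\<And>p. p \<in> P \<Longrightarrow> ((\<lambda>k. p (g k - L)) \<longlongrightarrow> 0) F"
  shows "(g \<longlongrightarrow> L) F"
proof (rule topological_tendstoI)
  fix S assume "open S" "L \<in> S"
  then obtain Q e where Q: "finite Q" "Q \<subseteq> P" "0 < e" "{y. \<forall>p\<in>Q. p (y - L) < e} \<subseteq> S"
    by (rule open_contains_seminorm_ball)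
  have "eventually (\<lambda>k. p (g k - L) < e) F" if "p \<in> Q" for p
    using order_tendstoD(2)[OF assms, of p e] that Q by auto
  then have "eventually (\<lambda>k. \<forall>p\<in>Q. p (g k - L) < e) F"
    using Q(1) by (simp add: eventually_ball_finite)
  then show "eventually (\<lambda>k. g k \<in> S) F"
    by eventually_elim (use Q(4) in auto)
qed

text \<open>The constant sequence \<open>x\<close> would converge to 0, and limits are unique in a
  Hausdorff space.\<close>

lemma seminorms_separate:
  assumes "\<And>p. p \<in> P \<Longrightarrow> p x = 0"
  shows "x = 0"
proof -
  have "((\<lambda>_::nat. x) \<longlongrightarrow> 0) sequentially"
    by (rule tendsto_if_seminorms) (simp add: assms)
  then show ?thesis by (simp add: LIMSEQ_const_iff)
qed

lemma convergent_if_seminorm_Cauchy: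
  fixes x :: "nat \<Rightarrow> 'a"
  assumes "\<And>p e. p \<in> P \<Longrightarrow> 0 < e \<Longrightarrow> \<exists>N. \<forall>k\<ge>N. \<forall>l\<ge>N. p (x k - x l) < e"
  shows "convergent x"
proof (rule seq_complete, unfold cauchy_seq_def, intro allI impI)
  fix U :: "'a set" assume "open U" "0 \<in> U"
  then obtain Q e where Q: "finite Q" "Q \<subseteq> P" "0 < e" "{y. \<forall>p\<in>Q. p (y - 0) < e} \<subseteq> U"
    by (rule open_contains_seminorm_ball)
  from Q(1,2) have "\<exists>N. \<forall>p\<in>Q. \<forall>k\<ge>N. \<forall>l\<ge>N. p (x k - x l) < e"
  proof (induction Q)
    case (insert q Q)
    then obtain N where N: "\<forall>p\<in>Q. \<forall>k\<ge>N. \<forall>l\<ge>N. p (x k - x l) < e" by auto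
    obtain N' where N': "\<forall>k\<ge>N'. \<forall>l\<ge>N'. q (x k - x l) < e" using assms[of q e] insert Q(3) by auto
    show ?case using N N' by (intro exI[of _ "max N N'"]) auto
  qed simp
  then show "\<exists>N. \<forall>k\<ge>N. \<forall>l\<ge>N. x k - x l \<in> U"
    using Q(4) by fastforce
qed

lemma dominated_functionalD:
  assumes "dominated_functional scal p \<phi>"
  shows "\<phi> (x + y) = \<phi> x + \<phi> y" "\<phi> (x - y) = \<phi> x - \<phi> y" "\<phi> (scal c x) = c * \<phi> x"
    "\<phi> (\<Sum>i\<in>I. u i) = (\<Sum>i\<in>I. \<phi> (u i))" "cmod (\<phi> x) \<le> p x"
proof -
  interpret Vector_Spaces.linear scal "(*)" \<phi> using assms by (simp add: dominated_functional_def)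
  show "\<phi> (x + y) = \<phi> x + \<phi> y" "\<phi> (x - y) = \<phi> x - \<phi> y" "\<phi> (scal c x) = c * \<phi> x"
    "\<phi> (\<Sum>i\<in>I. u i) = (\<Sum>i\<in>I. \<phi> (u i))" "cmod (\<phi> x) \<le> p x"
    using assms by (auto simp: add diff scale sum dominated_functional_def)
qed

lemma norming_functional:
  assumes "p \<in> P"
  obtains \<phi> where "dominated_functional scal p \<phi>" "cmod (\<phi> x) = p x"
  using hahn_banach_seminorm[OF vector_space_axioms seminorms[OF assms]] dominated_functional_def by metis

lemma tendsto_functional:
  assumes p: "p \<in> P" and \<phi>: "dominated_functional scal p \<phi>" and g: "(g \<longlongrightarrow> L) F"
  shows "((\<lambda>k. \<phi> (g k)) \<longlongrightarrow> \<phi> L) F"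
proof -
  have "((\<lambda>k. \<phi> (g k) - \<phi> L) \<longlongrightarrow> 0) F"
    by (rule Lim_null_comparison[OF _ tendsto_seminorm[OF p g]])
      (simp add: dominated_functionalD(2)[OF \<phi>, symmetric] dominated_functionalD(5)[OF \<phi>])
  then show ?thesis by (simp add: LIM_zero_iff)
qed

section \<open>The vector integral seen through functionals\<close>

lemma functional_simple_lc_integral:
  assumes \<phi>: "dominated_functional scal p \<phi>" and K: "K \<in> lmeasurable"
    and g: "simple_function (lebesgue_on K) g"
  shows "\<phi> (simple_lc_integral scal K g) = (LINT t|lebesgue_on K. \<phi> (g t))"
proof -
  interpret finite_measure "lebesgue_on K" by (rule finite_measure_lebesgue_on[OF K])
  have fin: "finite (g ` K)" and meas: "\<And>y. g -` {y} \<inter> K \<in> sets (lebesgue_on K)"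
    using simple_functionD[OF g] by auto
  have "(LINT t|lebesgue_on K. \<phi> (g t))
      = (LINT t|lebesgue_on K. (\<Sum>y\<in>g ` K. indicator (g -` {y} \<inter> K) t *\<^sub>R \<phi> y))"
  proof (rule Bochner_Integration.integral_cong[OF refl])
    fix t assume "t \<in> space (lebesgue_on K)"
    then have t: "t \<in> K" by simp
    have "(\<Sum>y\<in>g ` K. indicator (g -` {y} \<inter> K) t *\<^sub>R \<phi> y) = (\<Sum>y\<in>g ` K. if y = g t then \<phi> y else 0)"
      using t by (intro sum.cong) (auto simp: indicator_def)
    then show "\<phi> (g t) = (\<Sum>y\<in>g ` K. indicator (g -` {y} \<inter> K) t *\<^sub>R \<phi> y)"
      using t fin by simp
  qed
  also have "\<dots> = (\<Sum>y\<in>g ` K. LINT t|lebesgue_on K. indicator (g -` {y} \<inter> K) t *\<^sub>R \<phi> y)"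
    by (rule Bochner_Integration.integral_sum) (rule integrable_mult_indicator[OF meas integrable_const])
  also have "\<dots> = (\<Sum>y\<in>g ` K. of_real (measure lebesgue (g -` {y} \<inter> K)) * \<phi> y)"
  proof (rule sum.cong[OF refl])
    fix y
    have "(LINT t|lebesgue_on K. indicator (g -` {y} \<inter> K) t *\<^sub>R \<phi> y)
        = measure (lebesgue_on K) (g -` {y} \<inter> K) *\<^sub>R \<phi> y"
      using integrable_mult_indicator[OF meas[of y] integrable_const[of "1::real"]] by simp
    also have "measure (lebesgue_on K) (g -` {y} \<inter> K) = measure lebesgue (g -` {y} \<inter> K)"
      using K by (intro measure_restrict_space) auto
    finally show "(LINT t|lebesgue_on K. indicator (g -` {y} \<inter> K) t *\<^sub>R \<phi> y)
        = of_real (measure lebesgue (g -` {y} \<inter> K)) * \<phi> y"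
      by (simp add: scaleR_conv_of_real)
  qed
  also have "\<dots> = \<phi> (simple_lc_integral scal K g)"
    by (simp add: simple_lc_integral_def dominated_functionalD[OF \<phi>])
  finally show ?thesis by simp
qed

text \<open>Domination by \<open>p\<close> turns the Cauchy condition for \<open>p\<close> in
  \<open>approximating_seq\<close> into a Cauchy condition in L1 for the scalar simple
  functions.\<close>

lemma
  assumes p: "p \<in> P" and \<phi>: "dominated_functional scal p \<phi>" and K: "K \<in> lmeasurable"
    and g: "approximating_seq P K f g"
  shows integrable_functional: "integrable (lebesgue_on K) (\<lambda>t. \<phi> (f t))"
    and functional_simple_integrals_tendsto:
      "(\<lambda>k. \<phi> (simple_lc_integral scal K (g k))) \<longlonglongrightarrow> (LINT t|lebesgue_on K. \<phi> (f t))"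
proof -
  interpret finite_measure "lebesgue_on K" by (rule finite_measure_lebesgue_on[OF K])
  have simple: "simple_function (lebesgue_on K) (g k)" for k
    using g by (simp add: approximating_seq_def)
  have s: "integrable (lebesgue_on K) (\<lambda>t. \<phi> (g k t))" for k
    by (rule integrable_simple_function_compose[OF simple])
  have lim: "AE t in lebesgue_on K. (\<lambda>k. \<phi> (g k t)) \<longlonglongrightarrow> \<phi> (f t)"
  proof -
    have "AE t in lebesgue_on K. (\<lambda>k. g k t) \<longlonglongrightarrow> f t"
      using g by (simp add: approximating_seq_def)
    then show ?thesis by eventually_elim (rule tendsto_functional[OF p \<phi>])
  qed
  have f: "(\<lambda>t. \<phi> (f t)) \<in> borel_measurable (lebesgue_on K)"
    by (rule borel_measurable_lebesgue_on_AE_limit[OF _ _ lim]) (use K s in auto)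
  have cauchy: "\<exists>N. \<forall>k\<ge>N. \<forall>l\<ge>N. (LINT t|lebesgue_on K. cmod (\<phi> (g k t) - \<phi> (g l t))) \<le> e"
    if e: "0 < e" for e
  proof -
    obtain N where N: "\<And>k l. k \<ge> N \<Longrightarrow> l \<ge> N \<Longrightarrow> (LINT t|lebesgue_on K. p (g k t - g l t)) \<le> e"
      using g p e unfolding approximating_seq_def by blast
    have "(LINT t|lebesgue_on K. cmod (\<phi> (g k t) - \<phi> (g l t))) \<le> (LINT t|lebesgue_on K. p (g k t - g l t))" for k l
    proof (rule integral_mono)
      have "simple_function (lebesgue_on K) (\<lambda>t. g k t - g l t)"
        by (rule simple_function_compose2[OF simple simple])
      then show "integrable (lebesgue_on K) (\<lambda>t. p (g k t - g l t))"
        by (rule integrable_simple_function_compose)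
      show "integrable (lebesgue_on K) (\<lambda>t. cmod (\<phi> (g k t) - \<phi> (g l t)))" using s by auto
    qed (simp add: dominated_functionalD(5)[OF \<phi>] flip: dominated_functionalD(2)[OF \<phi>])
    then show ?thesis using N by (meson order_trans)
  qed
  show "integrable (lebesgue_on K) (\<lambda>t. \<phi> (f t))"
    by (rule integrable_L1_Cauchy_limit[OF f s lim cauchy])
  show "(\<lambda>k. \<phi> (simple_lc_integral scal K (g k))) \<longlonglongrightarrow> (LINT t|lebesgue_on K. \<phi> (f t))"
    using integral_L1_Cauchy_limit[OF f s lim cauchy]
    by (simp add: functional_simple_lc_integral[OF \<phi> K simple])
qed

text \<open>A functional that norms the difference of two integrals bounds it by the integral of
  \<open>p (g k t - g l t)\<close>, without a common refinement of the two simple functions.\<close>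

lemma simple_lc_integrals_convergent:
  assumes K: "K \<in> lmeasurable" and g: "approximating_seq P K f g"
  shows "convergent (\<lambda>k. simple_lc_integral scal K (g k))"
proof (rule convergent_if_seminorm_Cauchy)
  fix p and e :: real assume p: "p \<in> P" and e: "0 < e"
  interpret finite_measure "lebesgue_on K" by (rule finite_measure_lebesgue_on[OF K])
  have simple: "simple_function (lebesgue_on K) (g k)" for k
    using g by (simp add: approximating_seq_def)
  \<comment> \<open>Halving turns the non-strict bound of \<open>approximating_seq\<close> into a
    strict one.\<close>
  obtain N where N: "\<And>k l. k \<ge> N \<Longrightarrow> l \<ge> N \<Longrightarrow> (LINT t|lebesgue_on K. p (g k t - g l t)) \<le> e / 2"
    using g p e half_gt_zero unfolding approximating_seq_def by metis
  have "p (simple_lc_integral scal K (g k) - simple_lc_integral scal K (g l)) < e"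
    if "k \<ge> N" "l \<ge> N" for k l
  proof -
    let ?d = "simple_lc_integral scal K (g k) - simple_lc_integral scal K (g l)"
    obtain \<phi> where \<phi>: "dominated_functional scal p \<phi>" "cmod (\<phi> ?d) = p ?d"
      by (rule norming_functional[OF p])
    have int: "integrable (lebesgue_on K) (\<lambda>t. F (g k t))" for k and F :: "'a \<Rightarrow> complex"
      by (rule integrable_simple_function_compose[OF simple])
    have "\<phi> ?d = (LINT t|lebesgue_on K. \<phi> (g k t)) - (LINT t|lebesgue_on K. \<phi> (g l t))"
      by (simp add: dominated_functionalD(2)[OF \<phi>(1)] functional_simple_lc_integral[OF \<phi>(1) K simple])
    also have "\<dots> = (LINT t|lebesgue_on K. \<phi> (g k t - g l t))"
      by (simp add: dominated_functionalD(2)[OF \<phi>(1)] int)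
    also have "cmod \<dots> \<le> (LINT t|lebesgue_on K. p (g k t - g l t))"
    proof (rule order_trans[OF integral_norm_bound integral_mono])
      have diff: "simple_function (lebesgue_on K) (\<lambda>t. g k t - g l t)"
        by (rule simple_function_compose2[OF simple simple])
      show "integrable (lebesgue_on K) (\<lambda>t. p (g k t - g l t))"
        "integrable (lebesgue_on K) (\<lambda>t. cmod (\<phi> (g k t - g l t)))"
        by (rule integrable_simple_function_compose[OF diff])+
    qed (rule dominated_functionalD(5)[OF \<phi>(1)])
    also have "\<dots> \<le> e / 2" using N that by blast
    finally show ?thesis using \<phi>(2) e by simp
  qed
  then show "\<exists>N. \<forall>k\<ge>N. \<forall>l\<ge>N.
      p (simple_lc_integral scal K (g k) - simple_lc_integral scal K (g l)) < e"
    by blast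
qed

text \<open>The definite description must be shown to denote: a limit exists by sequential
  completeness, and two limits agree because functionals determine a point and their values depend
  on \<open>f\<close> only.\<close>

lemma functional_lc_integral:
  assumes p: "p \<in> P" and \<phi>: "dominated_functional scal p \<phi>" and K: "K \<in> lmeasurable"
    and f: "lc_integrable_on P f K"
  shows "\<phi> (lc_integral scal P K f) = (LINT t|lebesgue_on K. \<phi> (f t))"
proof -
  define Q where "Q = (\<lambda>y. \<exists>g. approximating_seq P K f g \<and>
    (\<lambda>k. simple_lc_integral scal K (g k)) \<longlonglongrightarrow> y)"
  \<comment> \<open>Stated for all seminorms, not just \<open>p\<close>, since uniqueness needs all
    of them to separate points.\<close>
  have val: "\<psi> y = (LINT t|lebesgue_on K. \<psi> (f t))"
    if q: "q \<in> P" "dominated_functional scal q \<psi>" and "Q y" for q \<psi> y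
  proof -
    obtain g where g: "approximating_seq P K f g" "(\<lambda>k. simple_lc_integral scal K (g k)) \<longlonglongrightarrow> y"
      using \<open>Q y\<close> by (auto simp: Q_def)
    show ?thesis
      by (rule LIMSEQ_unique[OF tendsto_functional[OF q g(2)]
            functional_simple_integrals_tendsto[OF q K g(1)]])
  qed
  obtain g where "approximating_seq P K f g" using f by (auto simp: lc_integrable_on_def)
  then obtain y where y: "Q y"
    using simple_lc_integrals_convergent[OF K] unfolding Q_def convergent_def by blast
  have "y' = y" if y': "Q y'" for y'
  proof -
    have "y' - y = 0"
    proof (rule seminorms_separate)
      fix q assume q: "q \<in> P"
      obtain \<psi> where \<psi>: "dominated_functional scal q \<psi>" "cmod (\<psi> (y' - y)) = q (y' - y)"
        by (rule norming_functional[OF q])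
      then show "q (y' - y) = 0"
        using val[OF q \<psi>(1) y] val[OF q \<psi>(1) y'] dominated_functionalD(2)[OF \<psi>(1), of y' y] by simp
    qed
    then show ?thesis by simp
  qed
  with y have "Q (lc_integral scal P K f)"
    unfolding lc_integral_def Q_def[symmetric] by (rule theI)
  then show ?thesis by (rule val[OF p \<phi>])
qed

text \<open>Needed to give meaning to the truncated transform. With simple d_k close to e, the
  Cauchy estimate for d_k g_k splits d_k g_k - d_l g_l into d_k (g_k - g_l) and (d_k - d_l)
  g_l.\<close>

lemma lc_integrable_on_mult:
  assumes K: "K \<in> lmeasurable" and f: "lc_integrable_on P f K"
    and e: "e \<in> borel_measurable (lebesgue_on K)" and B: "\<And>s. s \<in> K \<Longrightarrow> cmod (e s) \<le> B"
  shows "lc_integrable_on P (\<lambda>s. scal (e s) (f s)) K"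
proof -
  interpret finite_measure "lebesgue_on K" by (rule finite_measure_lebesgue_on[OF K])
  obtain d where d: "\<And>k. simple_function (lebesgue_on K) (d k)"
    and d_close: "\<And>k s. cmod (d k s - e s) \<le> 2 / real (Suc k)"
    using uniform_simple_approximation[OF e, of B] B by auto
  obtain g where g: "approximating_seq P K f g" using f by (auto simp: lc_integrable_on_def)
  have simple: "simple_function (lebesgue_on K) (g k)" for k
    using g by (simp add: approximating_seq_def)
  let ?G = "\<lambda>k s. scal (d k s) (g k s)"
  have G: "simple_function (lebesgue_on K) (?G k)" for k
    by (rule simple_function_compose2[OF d simple])
  have d_lim: "(\<lambda>k. d k s) \<longlonglongrightarrow> e s" for s
  proof -
    have "(\<lambda>k. 2 / real (Suc k)) \<longlonglongrightarrow> 0" by real_asymp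
    then have "(\<lambda>k. d k s - e s) \<longlonglongrightarrow> 0"
      by (rule Lim_null_comparison[rotated]) (simp add: d_close del: of_nat_Suc)
    then show ?thesis by (simp add: LIM_zero_iff)
  qed
  have "AE t in lebesgue_on K. (\<lambda>k. g k t) \<longlonglongrightarrow> f t"
    using g by (simp add: approximating_seq_def)
  then have lim: "AE t in lebesgue_on K. (\<lambda>k. ?G k t) \<longlonglongrightarrow> scal (e t) (f t)"
  proof eventually_elim
    case (elim t)
    show ?case
    proof (rule tendsto_if_seminorms)
      fix p assume p: "p \<in> P"
      have "(\<lambda>k. cmod (d k t) * p (g k t - f t) + cmod (d k t - e t) * p (f t)) \<longlonglongrightarrow>
          cmod (e t) * 0 + cmod (e t - e t) * p (f t)"
        by (intro tendsto_intros d_lim tendsto_seminorm[OF p elim])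
      then have "(\<lambda>k. cmod (d k t) * p (g k t - f t) + cmod (d k t - e t) * p (f t)) \<longlonglongrightarrow> 0" by simp
      then show "(\<lambda>k. p (?G k t - scal (e t) (f t))) \<longlonglongrightarrow> 0"
      proof (rule Lim_null_comparison[rotated], intro always_eventually allI)
        fix k
        have "?G k t - scal (e t) (f t) = scal (d k t) (g k t - f t) + scal (d k t - e t) (f t)"
          by (simp add: scale_right_diff_distrib scale_left_diff_distrib)
        then show "norm (p (?G k t - scal (e t) (f t)))
            \<le> cmod (d k t) * p (g k t - f t) + cmod (d k t - e t) * p (f t)"
          using seminorm_add[OF p, of "scal (d k t) (g k t - f t)" "scal (d k t - e t) (f t)"]
          by (simp add: seminorm_scale[OF p] seminorm_nonneg[OF p])
      qed
    qed
  qed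
  have cauchy: "\<exists>k0. \<forall>k\<ge>k0. \<forall>l\<ge>k0. (LINT t|lebesgue_on K. p (?G k t - ?G l t)) \<le> r"
    if p: "p \<in> P" and r: "0 < r" for p r
  proof -
    \<comment> \<open>A bound for every \<open>d k\<close> on \<open>K\<close>: the bound of
      \<open>e\<close> plus the largest error 2. Then \<open>\<delta>\<close> is chosen so that
      \<open>B' * \<delta>\<close> equals \<open>r / 2\<close>.\<close>
    define B' where "B' = \<bar>B\<bar> + 2"
    have B': "0 < B'" by (simp add: B'_def add_nonneg_pos)
    define \<delta> where "\<delta> = r / (2 * B')"
    have \<delta>: "0 < \<delta>" using r B' by (simp add: \<delta>_def)
    obtain N where N: "\<And>k l. k \<ge> N \<Longrightarrow> l \<ge> N \<Longrightarrow> (LINT t|lebesgue_on K. p (g k t - g l t)) \<le> \<delta>"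
      using g p \<delta> unfolding approximating_seq_def by blast
    \<comment> \<open>Bounds the integrals of \<open>p (g l t)\<close> uniformly for l \<ge>
      N.\<close>
    define C where "C = \<delta> + (LINT t|lebesgue_on K. p (g N t))"
    have int: "integrable (lebesgue_on K) (\<lambda>t. p (g k t))" for k
      by (rule integrable_simple_function_compose[OF simple])
    have intd: "integrable (lebesgue_on K) (\<lambda>t. p (g k t - g l t))" for k l
      by (rule integrable_simple_function_compose[OF simple_function_compose2[OF simple simple]])
    have "0 \<le> (LINT t|lebesgue_on K. p (g N t))" by (simp add: seminorm_nonneg[OF p])
    then have C0: "0 < C" using \<delta> by (simp add: C_def add_pos_nonneg)
    have C: "(LINT t|lebesgue_on K. p (g l t)) \<le> C" if "l \<ge> N" for l
    proof -
      have "(LINT t|lebesgue_on K. p (g l t)) \<le> (LINT t|lebesgue_on K. p (g l t - g N t) + p (g N t))"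
        by (intro integral_mono int intd Bochner_Integration.integrable_add seminorm_le_diff[OF p])
      also have "\<dots> = (LINT t|lebesgue_on K. p (g l t - g N t)) + (LINT t|lebesgue_on K. p (g N t))"
        by (intro Bochner_Integration.integral_add int intd)
      also have "\<dots> \<le> C" using N[OF that order_refl] by (simp add: C_def)
      finally show ?thesis .
    qed
    \<comment> \<open>The 4 in the next line comes from the two errors 2/(k+1) and 2/(l+1); 8 leaves
      the share \<open>r / 2\<close> for this summand.\<close>
    obtain N' where "8 * C / r \<le> real N'" using real_arch_simple by blast
    then have N': "4 / real (Suc N') * C \<le> r / 2" using r by (simp add: field_simps)
    have "(LINT t|lebesgue_on K. p (?G k t - ?G l t)) \<le> r" if kl: "k \<ge> max N N'" "l \<ge> max N N'" for k l
    proof -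
      have small: "2 / real (Suc i) \<le> 2 / real (Suc N')" if "i \<ge> N'" for i
        using that by (intro divide_left_mono) auto
      have bound: "p (?G k t - ?G l t) \<le> B' * p (g k t - g l t) + 4 / real (Suc N') * p (g l t)"
        if "t \<in> K" for t
      proof -
        have "2 / real (Suc k) \<le> 2" by (simp add: field_simps)
        then have "cmod (d k t) \<le> B'"
          using norm_triangle_sub[of "d k t" "e t"] d_close[of k t] B[OF that] by (simp add: B'_def)
        moreover have "cmod (d k t - d l t) \<le> 4 / real (Suc N')"
        proof -
          have "cmod (d k t - d l t) \<le> cmod (d k t - e t) + cmod (d l t - e t)"
            using norm_triangle_ineq4[of "d k t - e t" "d l t - e t"] by simp
          also have "\<dots> \<le> 2 / real (Suc N') + 2 / real (Suc N')"
            using kl by (intro add_mono order_trans[OF d_close small]) auto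
          finally show ?thesis by simp
        qed
        moreover have "?G k t - ?G l t = scal (d k t) (g k t - g l t) + scal (d k t - d l t) (g l t)"
          by (simp add: scale_right_diff_distrib scale_left_diff_distrib)
        then have "p (?G k t - ?G l t) \<le> cmod (d k t) * p (g k t - g l t) + cmod (d k t - d l t) * p (g l t)"
          using seminorm_add[OF p, of "scal (d k t) (g k t - g l t)" "scal (d k t - d l t) (g l t)"]
          by (simp add: seminorm_scale[OF p])
        ultimately show ?thesis
          by (meson add_mono mult_right_mono order_trans seminorm_nonneg[OF p])
      qed
      have "(LINT t|lebesgue_on K. p (?G k t - ?G l t))
          \<le> (LINT t|lebesgue_on K. B' * p (g k t - g l t) + 4 / real (Suc N') * p (g l t))"
      proof (rule integral_mono)
        show "integrable (lebesgue_on K) (\<lambda>t. p (?G k t - ?G l t))"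
          by (rule integrable_simple_function_compose[OF simple_function_compose2[OF G G]])
        show "integrable (lebesgue_on K) (\<lambda>t. B' * p (g k t - g l t) + 4 / real (Suc N') * p (g l t))"
          by (intro Bochner_Integration.integrable_add integrable_mult_right int intd)
      qed (use bound in simp)
      also have "\<dots> = B' * (LINT t|lebesgue_on K. p (g k t - g l t))
          + 4 / real (Suc N') * (LINT t|lebesgue_on K. p (g l t))"
        by (subst Bochner_Integration.integral_add) (auto intro!: integrable_mult_right int intd)
      also have "\<dots> \<le> B' * \<delta> + 4 / real (Suc N') * C"
        using kl B' by (intro add_mono mult_left_mono N C) auto
      also have "\<dots> \<le> r / 2 + r / 2" using B' N' by (intro add_mono) (auto simp: \<delta>_def)
      finally show ?thesis by simp
    qed
    then show ?thesis by blast
  qed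
  have "approximating_seq P K (\<lambda>s. scal (e s) (f s)) ?G"
    unfolding approximating_seq_def using G lim cauchy by blast
  then show ?thesis by (auto simp: lc_integrable_on_def)
qed

section \<open>From functionals to the seminorm\<close>

text \<open>The functionals norm the values of the approximants, not those of \<open>f\<close>. If
  the one for \<open>g k t\<close> kills \<open>f t\<close>, then \<open>p (g k t)\<close> is at
  most \<open>p (g k t - f t)\<close>, so \<open>p (f t)\<close> is at most twice that, which tends
  to 0.\<close>

lemma AE_seminorm_zero:
  assumes p: "p \<in> P" and f: "lc_integrable_on P f K"
    and zero: "\<And>\<phi>. dominated_functional scal p \<phi> \<Longrightarrow> AE t in lebesgue_on K. \<phi> (f t) = 0"
  shows "AE t in lebesgue_on K. p (f t) = 0"
proof -
  obtain g where g: "approximating_seq P K f g" using f by (auto simp: lc_integrable_on_def)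
  define D where "D = (\<Union>k. g k ` K)"
  have "finite (g k ` K)" for k
    using g simple_functionD(1)[of "lebesgue_on K" "g k"] by (simp add: approximating_seq_def)
  then have D: "countable D" unfolding D_def by (rule countable_UN[OF countableI_type countable_finite])
  have "\<exists>\<phi>. dominated_functional scal p \<phi> \<and> cmod (\<phi> y) = p y" for y
    using norming_functional[OF p, of y] by blast
  then obtain \<Phi> where \<Phi>: "\<And>y. dominated_functional scal p (\<Phi> y)" "\<And>y. cmod (\<Phi> y y) = p y"
    by metis
  have "AE t in lebesgue_on K. \<forall>y\<in>D. \<Phi> y (f t) = 0"
    using zero[OF \<Phi>(1)] by (simp add: AE_ball_countable[OF D])
  moreover have "AE t in lebesgue_on K. (\<lambda>k. g k t) \<longlonglongrightarrow> f t"
    using g by (simp add: approximating_seq_def)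
  ultimately show ?thesis
    using AE_space
  proof eventually_elim
    case (elim t)
    have "norm (p (f t)) \<le> 2 * p (g k t - f t)" for k
    proof -
      have "g k t \<in> D" using elim by (auto simp: D_def)
      then have "\<Phi> (g k t) (g k t - f t) = \<Phi> (g k t) (g k t)"
        using elim by (simp add: dominated_functionalD(2)[OF \<Phi>(1)])
      then have "p (g k t) \<le> p (g k t - f t)"
        using dominated_functionalD(5)[OF \<Phi>(1), of "g k t" "g k t - f t"] \<Phi>(2)[of "g k t"] by simp
      moreover have "p (f t) \<le> p (g k t - f t) + p (g k t)"
        using seminorm_le_diff[OF p, of "f t" "g k t"] seminorm_diff_commute[OF p, of "f t" "g k t"] by simp
      ultimately show ?thesis by (simp add: seminorm_nonneg[OF p])
    qed
    moreover have "(\<lambda>k. 2 * p (g k t - f t)) \<longlonglongrightarrow> 0"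
      by (intro tendsto_mult_right_zero tendsto_seminorm[OF p elim(2)])
    ultimately have "(\<lambda>k::nat. p (f t)) \<longlonglongrightarrow> 0"
      by (intro Lim_null_comparison[of "\<lambda>_. p (f t)" "\<lambda>k. 2 * p (g k t - f t)"] always_eventually allI)
    then show ?case by (simp add: LIMSEQ_const_iff)
  qed
qed

lemma lc_bounded_seminorm:
  assumes p: "p \<in> P" and "lc_bounded scal S"
  shows "\<exists>B. \<forall>x\<in>S. p x \<le> B"
proof -
  have "\<exists>r>0. \<forall>c. r < cmod c \<longrightarrow> S \<subseteq> scal c ` {y. p (y - 0) < 1}"
    by (rule assms(2)[unfolded lc_bounded_def, rule_format, OF open_seminorm_ball[OF p]])
      (simp add: seminorm_zero[OF p])
  then obtain r where r: "0 < r" "\<And>c. r < cmod c \<Longrightarrow> S \<subseteq> scal c ` {y. p y < 1}" by auto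
  \<comment> \<open>\<open>r + 1\<close> serves as a scalar of modulus beyond the threshold
    \<open>r\<close>.\<close>
  have "S \<subseteq> scal (of_real (r + 1)) ` {y. p y < 1}" using r(1) by (intro r(2)) simp
  then have "p x \<le> r + 1" if "x \<in> S" for x
  proof -
    obtain y where y: "x = scal (of_real (r + 1)) y" "p y < 1"
      using \<open>S \<subseteq> _\<close> \<open>x \<in> S\<close> by auto
    have "p x = (r + 1) * p y" using r(1) y(1) by (simp add: seminorm_scale[OF p] flip: of_real_add)
    also have "\<dots> \<le> (r + 1) * 1" using r(1) y(2) by (intro mult_left_mono) auto
    finally show ?thesis by simp
  qed
  then show ?thesis by blast
qed

end

section \<open>The vector-valued transform and its uniqueness\<close>

lemma filterlim_diagonal_coords_at_top:
  "filterlim (\<lambda>i::nat. (\<chi> j. real i) :: real^'n) coords_at_top sequentially"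
  unfolding coords_at_top_def
  by (auto simp: filterlim_INF filterlim_filtercomap_iff comp_def intro: filterlim_real_sequentially)

context sclcs
begin

text \<open>The kernel is continuous, hence bounded on the box, so the weighted function is
  integrable and the functional passes under the integral.\<close>

lemma integral_functional_laplace:
  fixes f :: "real^'n \<Rightarrow> 'a"
  assumes p: "p \<in> P" and \<phi>: "dominated_functional scal p \<phi>" and f: "lc_integrable_on P f (cbox 0 t)"
  shows "\<phi> (truncated_laplace scal P f l t) = (LINT u|lebesgue_on (cbox 0 t). laplace_kernel l u * \<phi> (f u))"
proof -
  have "compact (laplace_kernel l ` cbox 0 t)"
    by (intro compact_continuous_image compact_cbox continuous_laplace_kernel)
  then obtain B where B: "\<And>u. u \<in> cbox 0 t \<Longrightarrow> cmod (laplace_kernel l u) \<le> B"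
    by (force dest!: compact_imp_bounded simp: bounded_iff)
  have "laplace_kernel l \<in> borel_measurable (lebesgue_on (cbox 0 t))"
    using measurable_compose[OF measurable_lebesgue_on_borel borel_measurable_laplace_kernel] .
  then have "lc_integrable_on P (\<lambda>s. scal (laplace_kernel l s) (f s)) (cbox 0 t)"
    by (rule lc_integrable_on_mult[OF lmeasurable_cbox f _ B])
  from functional_lc_integral[OF p \<phi> _ this] show ?thesis
    by (simp add: truncated_laplace_def dominated_functionalD(3)[OF \<phi>] flip: laplace_kernel_def)
qed

lemma laplace_transform_unique_seminorm:
  fixes f :: "real^'n \<Rightarrow> 'a"
  assumes f: "locally_integrable P f" and l0: "l0 \<in> Omega_b scal P f"
    and a: "\<And>j. Re (l0 $ j) < a $ j"
    and lim: "\<And>l :: real^'n. (\<And>j. a $ j < l $ j) \<Longrightarrow>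
      has_laplace scal P f (\<chi> j. complex_of_real (l $ j)) 0"
    and p: "p \<in> P"
  shows "AE t in lebesgue. t \<in> orthant \<longrightarrow> p (f t) = 0"
proof -
  have fi: "lc_integrable_on P f (cbox 0 T)" for T
    using f by (auto simp: locally_integrable_def orthant_def mem_box_cart subset_iff)
  have *: "AE t in lebesgue. t \<in> orthant \<longrightarrow> \<phi> (f t) = 0" if \<phi>: "dominated_functional scal p \<phi>" for \<phi>
  proof -
    note TL = integral_functional_laplace[OF p \<phi> fi]
    have "lc_bounded scal (truncated_laplace scal P f l0 ` orthant)"
      using l0 by (simp add: Omega_b_def)
    from lc_bounded_seminorm[OF p this]
    obtain B where B: "p (truncated_laplace scal P f l0 t) \<le> B" if "t \<in> orthant" for t
      by auto
    show ?thesis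
    proof (rule laplace_transform_unique_scalar[OF _ _ a])
      show "integrable (lebesgue_on (cbox 0 T)) (\<lambda>t. \<phi> (f t))" for T
        using fi[of T] integrable_functional[OF p \<phi> lmeasurable_cbox]
        by (auto simp: lc_integrable_on_def)
      show "cmod (LINT u|lebesgue_on (cbox 0 t). laplace_kernel l0 u * \<phi> (f u)) \<le> B"
        if "t \<in> orthant" for t
        using order_trans[OF dominated_functionalD(5)[OF \<phi>] B[OF that]] by (simp add: TL)
      fix l :: "real^'n" assume "\<And>j. a $ j < l $ j"
      then have "(truncated_laplace scal P f (\<chi> j. complex_of_real (l $ j)) \<longlongrightarrow> 0) coords_at_top"
        using lim unfolding has_laplace_def by blast
      from filterlim_compose[OF tendsto_functional[OF p \<phi> this] filterlim_diagonal_coords_at_top]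
      show "(\<lambda>i. LINT u|lebesgue_on (cbox 0 (\<chi> j. real i)).
          laplace_kernel (\<chi> j. complex_of_real (l $ j)) u * \<phi> (f u)) \<longlonglongrightarrow> 0"
        using dominated_functionalD(2)[OF \<phi>, of 0 0] by (simp add: TL)
    qed
  qed
  show ?thesis
  \<comment> \<open>Approximating sequences are provided on compact sets only, so the passage from
    functionals to \<open>p\<close> is made box by box.\<close>
  proof (intro AE_orthant_if_AE_boxes AE_seminorm_zero[OF p fi])
    fix i :: nat and \<phi> assume "dominated_functional scal p \<phi>"
    from *[OF this] show "AE t in lebesgue_on (cbox 0 (\<chi> j. real i)). \<phi> (f t) = 0"
      by (subst AE_restrict_space_iff)
        (auto simp: orthant_def mem_box_cart elim!: eventually_mono)
  qed
qed

text \<open>Each metric ball around 0 of radius 1/(n+1) contains a neighbourhood given by finitely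
  many seminorms. A point killed by all of these seminorms lies in every ball.\<close>

lemma metrizable_countable_separating_seminorms:
  assumes "complete_invariant_metrizable TYPE('a)"
  shows "\<exists>Q. countable Q \<and> Q \<subseteq> P \<and> (\<forall>x. (\<forall>p\<in>Q. p x = 0) \<longrightarrow> x = 0)"
proof -
  have "\<exists>d :: 'a \<Rightarrow> 'a \<Rightarrow> real. Metric_space UNIV d \<and> Metric_space.mtopology UNIV d = euclidean"
    using assms[unfolded complete_invariant_metrizable_def] by (rule ex_forward) simp
  then obtain d :: "'a \<Rightarrow> 'a \<Rightarrow> real"
    where d: "Metric_space UNIV d" "Metric_space.mtopology UNIV d = euclidean"
    by (elim exE conjE)
  interpret M: Metric_space UNIV d by (rule d(1))
  have "\<exists>F. finite F \<and> F \<subseteq> P \<and> (\<forall>x. (\<forall>p\<in>F. p x = 0) \<longrightarrow> d 0 x < 1 / real (Suc n))" for n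
  proof -
    have o: "open (M.mball 0 (1 / real (Suc n)))"
      using M.openin_mball[of 0 "1 / real (Suc n)"] unfolding d(2) by (rule open_openin[THEN iffD2])
    have m: "0 \<in> M.mball 0 (1 / real (Suc n))" by simp
    obtain F e where F: "finite F" "F \<subseteq> P" "0 < e"
      "{y. \<forall>p\<in>F. p (y - 0) < e} \<subseteq> M.mball 0 (1 / real (Suc n))"
      by (rule open_contains_seminorm_ball[OF o m])
    have "d 0 x < 1 / real (Suc n)" if "\<forall>p\<in>F. p x = 0" for x
    proof -
      have "x \<in> M.mball 0 (1 / real (Suc n))" using that F(3) by (intro subsetD[OF F(4)]) auto
      then show ?thesis unfolding M.in_mball by (elim conjE)
    qed
    then show ?thesis using F by blast
  qed
  then obtain F where F: "\<And>n. finite (F n)" "\<And>n. F n \<subseteq> P"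
    "\<And>n x. \<forall>p\<in>F n. p x = 0 \<Longrightarrow> d 0 x < 1 / real (Suc n)"
    by metis
  show ?thesis
  proof (intro exI conjI allI impI)
    show "countable (\<Union>n. F n)" by (rule countable_UN[OF countableI_type countable_finite[OF F(1)]])
    show "(\<Union>n. F n) \<subseteq> P" using F(2) by blast
    fix x assume "\<forall>p\<in>(\<Union>n. F n). p x = 0"
    then have "d 0 x < 1 / real (Suc n)" for n by (intro F(3)) blast
    then have "d 0 x \<le> 0"
      by (meson nat_approx_posE not_le order_less_asym)
    then have "d 0 x = 0" using M.nonneg[of 0 x] by linarith
    then show "x = 0" by simp
  qed
qed

end

theorem theorem2p23:
  fixes scal :: "complex \<Rightarrow> 'a::{ab_group_add,t2_space} \<Rightarrow> 'a"
    and P :: "('a \<Rightarrow> real) set"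
    and f :: "real ^ 'n \<Rightarrow> 'a"
    and l0 :: "complex ^ 'n"
    and a :: "real ^ 'n"
  assumes "sclcs scal P"
    and "CARD('n) \<ge> 2"
    and "locally_integrable P f"
    and "l0 \<in> Omega_b scal P f"
    and "\<forall>j. a $ j > Re (l0 $ j)"
    and "\<forall>l :: real ^ 'n. (\<forall>j. l $ j > a $ j) \<longrightarrow>
           has_laplace scal P f (\<chi> j. complex_of_real (l $ j)) 0"
  shows "(\<forall>p\<in>P. \<exists>N. N \<subseteq> orthant \<and> N \<in> sets lebesgue \<and> emeasure lebesgue N = 0 \<and>
            (\<forall>t\<in>orthant - N. p (f t) = 0))
       \<and> (frechet scal P \<longrightarrow> (AE t in lebesgue_on orthant. f t = 0))"
proof -
  interpret sclcs scal P by fact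
  have AE0: "AE t in lebesgue. t \<in> orthant \<longrightarrow> p (f t) = 0" if "p \<in> P" for p
    using assms that by (intro laplace_transform_unique_seminorm[of f l0 a]) auto
  show ?thesis
  proof (intro conjI ballI impI)
    fix p assume "p \<in> P"
    \<comment> \<open>The exact exceptional set; it is Lebesgue measurable because subsets of null
      sets are.\<close>
    define N where "N = {t. \<not> (t \<in> orthant \<longrightarrow> p (f t) = 0)}"
    have "N \<in> null_sets lebesgue"
      using AE0[OF \<open>p \<in> P\<close>] by (simp add: completion.AE_iff_null_sets N_def)
    then have "N \<subseteq> orthant \<and> N \<in> sets lebesgue \<and> emeasure lebesgue N = 0 \<and>
        (\<forall>t\<in>orthant - N. p (f t) = 0)"
      by (auto simp: null_sets_def N_def)
    then show "\<exists>N. N \<subseteq> orthant \<and> N \<in> sets lebesgue \<and> emeasure lebesgue N = 0 \<and>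
        (\<forall>t\<in>orthant - N. p (f t) = 0)" by blast
  next
    assume "frechet scal P"
    then have "complete_invariant_metrizable TYPE('a)" by (simp add: frechet_def)
    from metrizable_countable_separating_seminorms[OF this]
    obtain Q where Q: "countable Q" "Q \<subseteq> P" "\<forall>x. (\<forall>p\<in>Q. p x = 0) \<longrightarrow> x = 0"
      by (elim exE conjE)
    \<comment> \<open>Countability of \<open>Q\<close> allows the null sets of the individual
      seminorms to be united.\<close>
    have "AE t in lebesgue. \<forall>p\<in>Q. t \<in> orthant \<longrightarrow> p (f t) = 0"
      unfolding AE_ball_countable[OF Q(1)] by (intro ballI AE0 subsetD[OF Q(2)])
    then have "AE t in lebesgue. t \<in> orthant \<longrightarrow> f t = 0"
      by eventually_elim (use Q(3) in simp)
    moreover have "(orthant :: (real^'n) set) = {0..}" by (auto simp: orthant_def less_eq_vec_def)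
    then have "closed (orthant :: (real^'n) set)" by (rule ssubst) (rule closed_eucl_atLeast)
    then have "(orthant :: (real^'n) set) \<in> sets lebesgue" by (auto intro: sets_completionI_sets)
    ultimately show "AE t in lebesgue_on orthant. f t = 0"
      by (subst AE_restrict_space_iff) auto
  qed
qed

end
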